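(* With the antimorphism $S$ defined below, for every $x \in \textsf{ParSym}$ one has $\nabla\big((S\otimes \mathrm{id})(\Delta x)\big) = \eta(\varepsilon(x)) = \nabla\big((\mathrm{id}\otimes S)(\Delta x)\big)$; that is, $S$ is an antipode and $\textsf{ParSym}$ is a Hopf algebra.
   Context: Partition diagrams of order $k$ are set partitions of $\{1,\ldots,k,1',\ldots,k'\}$; $A_k$ is the set of them, $A_0=\{\varnothing\}$. For $\pi$ of order $k$, $\rho$ of order $l$: $\pi\otimes\rho$ has as blocks those of $\pi$ and those of $\rho$ shifted ($i\mapsto i+k$, $i'\mapsto(i+k)'$). A diagram is $\otimes$-irreducible if it is not $\rho^{(1)}\otimes\rho^{(2)}$ with both factors nonempty. For nonempty $\pi,\rho$ (orders $k,l$), $\pi\bullet\rho$ is obtained from $\pi\otimes\rho$ by merging the block containing $k'$ with the block containing $(k+1)'$; $\varnothing\bullet\rho=\rho$, $\pi\bullet\varnothing=\pi$. Over a field $\mathbbm{k}$, $\textsf{ParSym}$ has basis $\{\textsf{H}_\pi : \pi\in A_i, i\geq0\}$, product $\nabla$ given by $\textsf{H}_\pi\textsf{H}_\rho=\textsf{H}_{\pi\otimes\rho}$, unit $\eta(1)=\textsf{H}_\varnothing$; it is free on the $\textsf{H}_\pi$, $\pi$ nonempty $\otimes$-irreducible. Counit: $\varepsilon(\textsf{H}_\varnothing)=1$, $\varepsilon(\textsf{H}_\pi)=0$ for $\pi$ nonempty. Coproduct: the algebra morphism with $\Delta\textsf{H}_\varnothing=\textsf{H}_\varnothing\otimes\textsf{H}_\varnothing$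 and, for nonempty $\otimes$-irreducible $\pi$, $\Delta\textsf{H}_\pi=\sum\textsf{H}_{G_1}\otimes\textsf{H}_{G_2}$ over ordered pairs $(G_1,G_2)$ of diagrams, each $\varnothing$ or $\otimes$-irreducible, with $G_1\bullet G_2=\pi$. The map $S$ is the linear algebra antimorphism ($S(xy)=S(y)S(x)$) with $S(\textsf{H}_\varnothing)=\textsf{H}_\varnothing$ and, for nonempty $\otimes$-irreducible $\pi$, $S(\textsf{H}_\pi)=\sum(-1)^\ell\textsf{H}_{\rho^{(1)}}\cdots\textsf{H}_{\rho^{(\ell)}}$, summed over all tuples $(\rho^{(1)},\ldots,\rho^{(\ell)})$, $\ell\geq1$, of nonempty diagrams with $\rho^{(1)}\bullet\cdots\bullet\rho^{(\ell)}=\pi$. *)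

theory Defs
  imports Complex_Main "HOL-Library.Poly_Mapping" "HOL-Library.Product_Plus" "HOL-Library.Disjoint_Sets"
begin

section \<open>Partition diagrams\<close>

text \<open>The vertices \<open>i\<close> and \<open>i'\<close> are \<open>Plain i\<close> and \<open>Prime i\<close>.\<close>

datatype vertex = Plain nat | Prime nat

fun shift :: "nat \<Rightarrow> vertex \<Rightarrow> vertex" where
  "shift k (Plain i) = Plain (i + k)"
| "shift k (Prime i) = Prime (i + k)"

definition vertices :: "nat \<Rightarrow> vertex set" where
  "vertices k = Plain ` {1..k} \<union> Prime ` {1..k}"

text \<open>The order of a diagram is recovered from its blocks, so diagrams of all orders form one type.\<close>

typedef diagram = "{P. \<exists>k. partition_on (vertices k) P}"
  morphisms blocks Abs_diagram
proof
  have "partition_on (vertices 0) {}" by (simp add: vertices_def partition_on_def)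
  then show "{} \<in> {P. \<exists>k. partition_on (vertices k) P}" by blast
qed

setup_lifting type_definition_diagram

definition block_order :: "vertex set set \<Rightarrow> nat" where
  "block_order P = (THE k. \<Union>P = vertices k)"

lemma vertices_inj: "vertices k = vertices l \<longleftrightarrow> k = l"
proof
  assume eq: "vertices k = vertices l"
  have "{i. Plain i \<in> vertices m} = {1..m}" for m by (auto simp: vertices_def)
  with eq have "{1..k} = {1..l}" by metis
  then show "k = l" by (metis card_atLeastAtMost diff_Suc_1)
qed simp

lemma block_order_eq: "partition_on (vertices k) P \<Longrightarrow> block_order P = k"
  by (auto simp: block_order_def vertices_inj partition_on_def)

lemma shift_add: "shift k (shift l v) = shift (k + l) v"
  by (cases v) auto

lemma shift_zero: "shift 0 = id"
proof
  show "shift 0 v = id v" for v by (cases v) auto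
qed

lemma inj_shift: "inj (shift k)"
proof (rule injI)
  show "u = v" if "shift k u = shift k v" for u v
    using that by (cases u; cases v) auto
qed

lemma image_plus_atLeastAtMost: "f ` {1..k + l} = f ` {1..k} \<union> (\<lambda>i. f (i + k)) ` {1..l::nat}"
proof -
  have "{1..k + l} = {1..k} \<union> (\<lambda>i. i + k) ` {1..l}"
    by (auto simp: image_add_atLeastAtMost')
  then show ?thesis by (simp only: image_Un image_image)
qed

lemma vertices_add: "vertices (k + l) = vertices k \<union> shift k ` vertices l"
  by (simp only: vertices_def image_Un image_image shift.simps image_plus_atLeastAtMost) blast

lemma vertices_shift_disjoint: "vertices k \<inter> shift k ` vertices l = {}"
  by (auto simp: vertices_def)

definition tensor_blocks :: "vertex set set \<Rightarrow> vertex set set \<Rightarrow> vertex set set" where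
  "tensor_blocks P Q = P \<union> (`) (shift (block_order P)) ` Q"

lemma partition_on_tensor_blocks:
  assumes P: "partition_on (vertices k) P" and Q: "partition_on (vertices l) Q"
  shows "partition_on (vertices (k + l)) (tensor_blocks P Q)"
proof -
  have "{} \<notin> (`) (shift k) ` Q" using Q by (auto simp: partition_on_def)
  then have R: "partition_on (shift k ` vertices l) ((`) (shift k) ` Q)" (is "partition_on _ ?R")
    using partition_on_inj_image[OF Q inj_on_subset[OF inj_shift subset_UNIV], of k] by simp
  have "disjnt p q" if p: "p \<in> P" and q: "q \<in> ?R" for p q
  proof -
    have "p \<subseteq> vertices k" using p partition_onD1[OF P] by blast
    moreover have "q \<subseteq> shift k ` vertices l" using q partition_onD1[OF R] by blast
    ultimately show ?thesis using vertices_shift_disjoint[of k l] unfolding disjnt_def by blast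
  qed
  then have "disjoint (P \<union> ?R)"
    using partition_onD2[OF P] partition_onD2[OF R] unfolding pairwise_def
    by (meson UnE disjnt_sym)
  then show ?thesis
    using partition_onD1[OF P] partition_onD1[OF R] partition_onD3[OF P] partition_onD3[OF R]
    unfolding partition_on_def tensor_blocks_def block_order_eq[OF P] vertices_add by simp
qed

text \<open>
  \<open>\<otimes>\<close> is written \<open>+\<close> and the empty diagram is \<open>0\<close>. The library's convolution product on
  \<^typ>\<open>diagram \<Rightarrow>\<^sub>0 'k\<close> then is the product of ParSym, and that on
  \<^typ>\<open>diagram \<times> diagram \<Rightarrow>\<^sub>0 'k\<close> the product of the tensor square of ParSym.
\<close>

instantiation diagram :: monoid_add
begin

lift_definition zero_diagram :: diagram is "{}"
  by (rule exI[of _ 0]) (simp add: vertices_def partition_on_def)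

lift_definition plus_diagram :: "diagram \<Rightarrow> diagram \<Rightarrow> diagram" is tensor_blocks
  using partition_on_tensor_blocks by blast

instance
proof
  show "a + b + c = a + (b + c)" for a b c :: diagram
  proof transfer
    fix P Q R
    assume "\<exists>k. partition_on (vertices k) P" "\<exists>k. partition_on (vertices k) Q"
    then obtain k l where P: "partition_on (vertices k) P" and Q: "partition_on (vertices l) Q"
      by blast
    show "tensor_blocks (tensor_blocks P Q) R = tensor_blocks P (tensor_blocks Q R)"
      using block_order_eq[OF partition_on_tensor_blocks[OF P Q]] block_order_eq[OF P] block_order_eq[OF Q]
      by (simp add: tensor_blocks_def image_Un image_image shift_add Un_assoc)
  qed
  have "partition_on (vertices 0) {}" by (simp add: vertices_def partition_on_def)
  from block_order_eq[OF this] show "0 + a = a" for a :: diagram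
    by transfer (simp add: tensor_blocks_def shift_zero)
  show "a + 0 = a" for a :: diagram
    by transfer (simp add: tensor_blocks_def)
qed

end

definition tensor_irreducible :: "diagram \<Rightarrow> bool" where
  "tensor_irreducible \<pi> \<longleftrightarrow> \<not> (\<exists>\<rho>1 \<rho>2. \<rho>1 \<noteq> 0 \<and> \<rho>2 \<noteq> 0 \<and> \<pi> = \<rho>1 + \<rho>2)"

definition merge_blocks :: "vertex \<Rightarrow> vertex \<Rightarrow> vertex set set \<Rightarrow> vertex set set" where
  "merge_blocks u v P = {B \<in> P. u \<notin> B \<and> v \<notin> B} \<union> {\<Union>{B \<in> P. u \<in> B \<or> v \<in> B}}"

lemma partition_on_merge_blocks:
  assumes P: "partition_on A P" and u: "u \<in> A"
  shows "partition_on A (merge_blocks u v P)"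
proof -
  have "\<Union>(merge_blocks u v P) = A"
    using P by (auto simp: merge_blocks_def partition_on_def)
  moreover have "disjoint (merge_blocks u v P)"
    using P unfolding merge_blocks_def partition_on_def disjoint_def by blast
  moreover have "{} \<notin> merge_blocks u v P"
    using P u unfolding merge_blocks_def partition_on_def by blast
  ultimately show ?thesis by (simp add: partition_on_def)
qed

lift_definition bullet :: "diagram \<Rightarrow> diagram \<Rightarrow> diagram" (infixr \<open>\<bullet>\<close> 65) is
  "\<lambda>P Q. if P = {} then Q else if Q = {} then P
     else merge_blocks (Prime (block_order P)) (Prime (block_order P + 1)) (tensor_blocks P Q)"
proof -
  fix P Q
  assume "\<exists>k. partition_on (vertices k) P" and "\<exists>k. partition_on (vertices k) Q"
  then obtain k l where P: "partition_on (vertices k) P" and Q: "partition_on (vertices l) Q"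
    by blast
  have "k \<noteq> 0" if "P \<noteq> {}"
  proof
    assume "k = 0"
    with P have "partition_on {} P" by (simp add: vertices_def)
    with that show False by (simp add: partition_on_empty)
  qed
  then have u: "Prime k \<in> vertices (k + l)" if "P \<noteq> {}"
    using that by (simp add: vertices_def image_iff)
  show "\<exists>k. partition_on (vertices k) (if P = {} then Q else if Q = {} then P
     else merge_blocks (Prime (block_order P)) (Prime (block_order P + 1)) (tensor_blocks P Q))"
  proof (cases "P = {} \<or> Q = {}")
    case True
    then show ?thesis using P Q by metis
  next
    case False
    then show ?thesis
      using partition_on_merge_blocks[OF partition_on_tensor_blocks[OF P Q] u, of "Prime (k + 1)"]
      by (metis block_order_eq[OF P])
  qed
qed


section \<open>Vector spaces with a basis, and Hopf algebras\<close>

text \<open>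
  The vector space over a field \<open>'k\<close> with basis indexed by \<open>'a\<close> is \<^typ>\<open>'a \<Rightarrow>\<^sub>0 'k\<close>, with
  basis vectors \<open>H a\<close>. The tensor product of \<^typ>\<open>'a \<Rightarrow>\<^sub>0 'k\<close> and \<^typ>\<open>'b \<Rightarrow>\<^sub>0 'k\<close> is
  \<^typ>\<open>'a \<times> 'b \<Rightarrow>\<^sub>0 'k\<close>, in which \<open>H (a, b)\<close> is the tensor of \<open>H a\<close> and \<open>H b\<close>.
\<close>

abbreviation H :: "'a \<Rightarrow> 'a \<Rightarrow>\<^sub>0 'k::field" where
  "H a \<equiv> Poly_Mapping.single a 1"

definition scale :: "'k::field \<Rightarrow> ('a \<Rightarrow>\<^sub>0 'k) \<Rightarrow> ('a \<Rightarrow>\<^sub>0 'k)" where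
  "scale c = Poly_Mapping.map ((*) c)"

lemma lookup_scale [simp]: "Poly_Mapping.lookup (scale c x) a = c * Poly_Mapping.lookup x a"
  by (simp add: scale_def map.rep_eq when_def)

lemma vector_space_scale: "vector_space (scale :: 'k::field \<Rightarrow> ('a \<Rightarrow>\<^sub>0 'k) \<Rightarrow> ('a \<Rightarrow>\<^sub>0 'k))"
  by unfold_locales (rule poly_mapping_eqI; simp add: lookup_add algebra_simps)+

definition lin_ext :: "('a \<Rightarrow> ('b \<Rightarrow>\<^sub>0 'k::field)) \<Rightarrow> ('a \<Rightarrow>\<^sub>0 'k) \<Rightarrow> ('b \<Rightarrow>\<^sub>0 'k)" where
  "lin_ext f x = (\<Sum>a\<in>Poly_Mapping.keys x. scale (Poly_Mapping.lookup x a) (f a))"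

definition tensor :: "('a \<Rightarrow>\<^sub>0 'k::field) \<Rightarrow> ('b \<Rightarrow>\<^sub>0 'k) \<Rightarrow> ('a \<times> 'b \<Rightarrow>\<^sub>0 'k)" where
  "tensor x y = lin_ext (\<lambda>a. lin_ext (\<lambda>b. H (a, b)) y) x"

definition tensor_map :: "(('a \<Rightarrow>\<^sub>0 'k::field) \<Rightarrow> ('c \<Rightarrow>\<^sub>0 'k)) \<Rightarrow> (('b \<Rightarrow>\<^sub>0 'k) \<Rightarrow> ('d \<Rightarrow>\<^sub>0 'k))
    \<Rightarrow> ('a \<times> 'b \<Rightarrow>\<^sub>0 'k) \<Rightarrow> ('c \<times> 'd \<Rightarrow>\<^sub>0 'k)" where
  "tensor_map f g = lin_ext (\<lambda>(a, b). tensor (f (H a)) (g (H b)))"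

definition tensor_assoc :: "(('a \<times> 'b) \<times> 'c \<Rightarrow>\<^sub>0 'k::field) \<Rightarrow> ('a \<times> 'b \<times> 'c \<Rightarrow>\<^sub>0 'k)" where
  "tensor_assoc = lin_ext (\<lambda>((a, b), c). H (a, b, c))"

definition tensor_middle_swap ::
    "(('a \<times> 'b) \<times> ('c \<times> 'd) \<Rightarrow>\<^sub>0 'k::field) \<Rightarrow> (('a \<times> 'c) \<times> ('b \<times> 'd) \<Rightarrow>\<^sub>0 'k)" where
  "tensor_middle_swap = lin_ext (\<lambda>((a, b), (c, d)). H ((a, c), (b, d)))"

locale hopf_algebra =
  fixes mult :: "('b \<times> 'b \<Rightarrow>\<^sub>0 'k::field) \<Rightarrow> ('b \<Rightarrow>\<^sub>0 'k)"
    and unit :: "'k \<Rightarrow> ('b \<Rightarrow>\<^sub>0 'k)"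
    and comult :: "('b \<Rightarrow>\<^sub>0 'k) \<Rightarrow> ('b \<times> 'b \<Rightarrow>\<^sub>0 'k)"
    and counit :: "('b \<Rightarrow>\<^sub>0 'k) \<Rightarrow> 'k"
    and antipode :: "('b \<Rightarrow>\<^sub>0 'k) \<Rightarrow> ('b \<Rightarrow>\<^sub>0 'k)"
  assumes linear_mult: "Vector_Spaces.linear scale scale mult"
    and linear_unit: "Vector_Spaces.linear (*) scale unit"
    and linear_comult: "Vector_Spaces.linear scale scale comult"
    and linear_counit: "Vector_Spaces.linear scale (*) counit"
    and linear_antipode: "Vector_Spaces.linear scale scale antipode"
    and mult_assoc: "mult (tensor_map mult id t) = mult (tensor_map id mult (tensor_assoc t))"
    and mult_unit_left: "mult (tensor (unit c) x) = scale c x"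
    and mult_unit_right: "mult (tensor x (unit c)) = scale c x"
    and comult_coassoc: "tensor_assoc (tensor_map comult id (comult x)) = tensor_map id comult (comult x)"
    and counit_left: "lin_ext (\<lambda>(a, b). scale (counit (H a)) (H b)) (comult x) = x"
    and counit_right: "lin_ext (\<lambda>(a, b). scale (counit (H b)) (H a)) (comult x) = x"
    and comult_mult:
      "comult (mult u) = tensor_map mult mult (tensor_middle_swap (tensor_map comult comult u))"
    and comult_unit: "comult (unit 1) = tensor (unit 1) (unit 1)"
    and counit_mult: "counit (mult (tensor x y)) = counit x * counit y"
    and counit_unit: "counit (unit 1) = 1"
    and antipode_left: "mult (tensor_map antipode id (comult x)) = unit (counit x)"
    and antipode_right: "mult (tensor_map id antipode (comult x)) = unit (counit x)"


section \<open>The structure maps of ParSym\<close>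

type_synonym 'k parsym = "diagram \<Rightarrow>\<^sub>0 'k"

lemma H_mult_H: "H \<pi> * H \<rho> = (H (\<pi> + \<rho>) :: 'k::field parsym)"
  by (simp add: mult_single)

lemma tensor_H_H: "tensor (H a) (H b) = H (a, b)"
  by (rule poly_mapping_eqI) (simp add: tensor_def lin_ext_def)

definition nabla :: "(diagram \<times> diagram \<Rightarrow>\<^sub>0 'k::field) \<Rightarrow> 'k parsym" where
  "nabla = lin_ext (\<lambda>(\<pi>, \<rho>). H \<pi> * H \<rho>)"

definition eta :: "'k::field \<Rightarrow> 'k parsym" where
  "eta c = scale c (H 0)"

definition epsilon :: "'k::field parsym \<Rightarrow> 'k" where
  "epsilon x = (\<Sum>\<pi>\<in>Poly_Mapping.keys x. Poly_Mapping.lookup x \<pi> * (if \<pi> = 0 then 1 else 0))"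

definition bullet_pairs :: "diagram \<Rightarrow> (diagram \<times> diagram) set" where
  "bullet_pairs \<pi> = {(G1, G2). (G1 = 0 \<or> tensor_irreducible G1) \<and>
     (G2 = 0 \<or> tensor_irreducible G2) \<and> G1 \<bullet> G2 = \<pi>}"

text \<open>
  The coproduct and \<open>S\<close> are the unique maps with the prescribed values on the generators; they exist
  and are unique because ParSym is free on the \<open>H \<pi>\<close> with \<open>\<pi>\<close> nonempty and \<open>\<otimes>\<close>-irreducible.
\<close>

definition is_coproduct :: "('k::field parsym \<Rightarrow> (diagram \<times> diagram \<Rightarrow>\<^sub>0 'k)) \<Rightarrow> bool" where
  "is_coproduct D \<longleftrightarrow> Vector_Spaces.linear scale scale D \<and>
     (\<forall>x y. D (x * y) = D x * D y) \<and>
     D (H 0) = tensor (H 0) (H 0) \<and>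
     (\<forall>\<pi>. \<pi> \<noteq> 0 \<and> tensor_irreducible \<pi> \<longrightarrow>
        D (H \<pi>) = (\<Sum>(G1, G2)\<in>bullet_pairs \<pi>. tensor (H G1) (H G2)))"

definition Delta :: "'k::field parsym \<Rightarrow> (diagram \<times> diagram \<Rightarrow>\<^sub>0 'k)" where
  "Delta = (THE D. is_coproduct D)"

text \<open>\<open>0\<close> is a right unit of \<open>\<bullet>\<close>, so the fold is \<open>\<rho>1 \<bullet> \<dots> \<bullet> \<rho>l\<close>.\<close>

definition bullet_tuples :: "diagram \<Rightarrow> diagram list set" where
  "bullet_tuples \<pi> = {\<rho>s. \<rho>s \<noteq> [] \<and> (\<forall>\<rho>\<in>set \<rho>s. \<rho> \<noteq> 0) \<and> foldr (\<bullet>) \<rho>s 0 = \<pi>}"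

definition is_antimorphism_S :: "('k::field parsym \<Rightarrow> 'k parsym) \<Rightarrow> bool" where
  "is_antimorphism_S S \<longleftrightarrow> Vector_Spaces.linear scale scale S \<and>
     (\<forall>x y. S (x * y) = S y * S x) \<and>
     S (H 0) = H 0 \<and>
     (\<forall>\<pi>. \<pi> \<noteq> 0 \<and> tensor_irreducible \<pi> \<longrightarrow>
        S (H \<pi>) = (\<Sum>\<rho>s\<in>bullet_tuples \<pi>. scale ((-1) ^ length \<rho>s) (prod_list (map H \<rho>s))))"

definition antipode_S :: "'k::field parsym \<Rightarrow> 'k parsym" where
  "antipode_S = (THE S. is_antimorphism_S S)"

end

theory Submission
  imports Defs
begin

text \<open>
  A diagram is a tensor product at height \<open>m\<close> exactly if no block meets both the first \<open>m\<close> columns and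
  the later ones. Hence the monoid of diagrams is equidivisible and graded, so it is free on the
  nonempty \<open>\<otimes>\<close>-irreducible diagrams, and algebra (anti)morphisms may be prescribed there. The product
  \<open>\<bullet>\<close> is associative, and \<open>a \<bullet> b\<close> is irreducible exactly if \<open>a\<close> and \<open>b\<close> are; therefore on
  irreducible \<open>\<pi>\<close> the coproduct runs over all factorizations \<open>\<pi> = a \<bullet> b\<close>, which gives coassociativity.
  Splitting off the last factor of a tuple \<open>\<rho>1 \<bullet> \<dots> \<bullet> \<rho>l = \<pi>\<close> changes the sign, so the terms with
  \<open>b \<noteq> 0\<close> in \<open>\<Sum> S(a) b\<close> add up to \<open>- S(\<pi>)\<close> and cancel the term with \<open>b = 0\<close>; symmetrically for
  \<open>\<Sum> a S(b)\<close>. Since \<open>S\<close> is an antimorphism, the antipode identities pass from generators to products.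
\<close>


section \<open>The free monoid of diagrams\<close>


definition diagram_order :: "diagram \<Rightarrow> nat" where
  "diagram_order \<pi> = block_order (blocks \<pi>)"

lemma partition_on_blocks: "partition_on (vertices (diagram_order \<pi>)) (blocks \<pi>)"
  using blocks[of \<pi>] block_order_eq unfolding diagram_order_def by auto

lemma diagram_order_eq: "partition_on (vertices k) (blocks \<pi>) \<Longrightarrow> diagram_order \<pi> = k"
  by (simp add: diagram_order_def block_order_eq)

lemma Union_blocks: "\<Union>(blocks \<pi>) = vertices (diagram_order \<pi>)"
  using partition_on_blocks partition_onD1 by metis

lemma block_subset: "B \<in> blocks \<pi> \<Longrightarrow> B \<subseteq> vertices (diagram_order \<pi>)"
  using Union_blocks by blast

lemma block_nonempty: "B \<in> blocks \<pi> \<Longrightarrow> B \<noteq> {}"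
  using partition_on_blocks partition_onD3 by blast

lemma exists_diagram:
  assumes "partition_on (vertices k) P"
  shows "\<exists>\<pi>. blocks \<pi> = P \<and> diagram_order \<pi> = k"
proof (intro exI conjI)
  show *: "blocks (Abs_diagram P) = P"
    using assms by (intro Abs_diagram_inverse) blast
  then show "diagram_order (Abs_diagram P) = k"
    using assms by (intro diagram_order_eq) simp
qed

lemma blocks_add: "blocks (a + b) = blocks a \<union> (`) (shift (diagram_order a)) ` blocks b"
  by (simp add: plus_diagram.rep_eq tensor_blocks_def diagram_order_def)

lemma diagram_order_add [simp]: "diagram_order (a + b) = diagram_order a + diagram_order b"
  using partition_on_tensor_blocks[OF partition_on_blocks[of a] partition_on_blocks[of b]]
  by (simp add: diagram_order_eq plus_diagram.rep_eq)

lemma vertices_zero [simp]: "vertices 0 = {}"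
  by (simp add: vertices_def)

lemma vertices_mono: "k \<le> l \<Longrightarrow> vertices k \<subseteq> vertices l"
  by (auto simp: vertices_def)

lemma Prime_in_vertices [simp]: "Prime i \<in> vertices k \<longleftrightarrow> 1 \<le> i \<and> i \<le> k"
  by (auto simp: vertices_def)

lemma diagram_order_eq_0_iff [simp]: "diagram_order \<pi> = 0 \<longleftrightarrow> \<pi> = 0"
proof
  assume "diagram_order \<pi> = 0"
  then show "\<pi> = 0"
    using partition_on_blocks[of \<pi>] by (simp add: partition_on_empty blocks_inject[symmetric] zero_diagram.rep_eq)
next
  assume "\<pi> = 0"
  then show "diagram_order \<pi> = 0"
    by (intro diagram_order_eq) (simp add: zero_diagram.rep_eq partition_on_empty)
qed

lemma diagram_order_pos_iff [simp]: "0 < diagram_order \<pi> \<longleftrightarrow> \<pi> \<noteq> 0"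
  by (simp flip: diagram_order_eq_0_iff)

lemma diagram_order_zero [simp]: "diagram_order 0 = 0"
  by simp

lemma diagram_add_eq_0_iff [simp]: "a + b = 0 \<longleftrightarrow> a = 0 \<and> (b :: diagram) = 0"
  by (simp flip: diagram_order_eq_0_iff)

text \<open>The block set of such a diagram is a set of subsets of the finite set
  \<open>vertices n\<close>. The finiteness of all factorization sums below rests on this.\<close>

lemma finite_diagram_order_le: "finite {\<pi>. diagram_order \<pi> \<le> n}"
proof (rule finite_imageD)
  have "blocks ` {\<pi>. diagram_order \<pi> \<le> n} \<subseteq> Pow (Pow (vertices n))"
    using block_subset vertices_mono by (fastforce)
  then show "finite (blocks ` {\<pi>. diagram_order \<pi> \<le> n})"
    by (rule finite_subset) (simp add: vertices_def)
  show "inj_on blocks {\<pi>. diagram_order \<pi> \<le> n}"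
    by (simp add: blocks_inject inj_on_def)
qed

text \<open>A nonempty shifted block lies beyond the columns of \<open>a\<close>, so the left factor
  can be read off from the product once its order is known. Together with
  \<open>blocks_add_right\<close> this gives cancellation.\<close>

lemma blocks_add_left: "blocks a = {B \<in> blocks (a + b). B \<subseteq> vertices (diagram_order a)}"
proof -
  have "\<not> shift (diagram_order a) ` B \<subseteq> vertices (diagram_order a)" if "B \<in> blocks b" for B
    using block_nonempty[OF that] block_subset[OF that] vertices_shift_disjoint[of "diagram_order a" "diagram_order b"] by blast
  then show ?thesis
    using block_subset by (auto simp: blocks_add)
qed

lemma blocks_add_right:
  "blocks b = {B. shift (diagram_order a) ` B \<in> blocks (a + b) \<and> B \<noteq> {} \<and> B \<subseteq> vertices (diagram_order b)}"
proof -
  have "shift (diagram_order a) ` B \<notin> blocks a" if "B \<noteq> {}" "B \<subseteq> vertices (diagram_order b)" for B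
    using that block_subset[of "shift (diagram_order a) ` B" a]
      vertices_shift_disjoint[of "diagram_order a" "diagram_order b"] by blast
  then show ?thesis
    using block_nonempty[of _ b] block_subset[of _ b]
    by (auto simp: blocks_add inj_image_eq_iff[OF inj_shift] simp del: image_is_empty)
qed

text \<open>Such an \<open>m\<close> is a cut: no block crosses from the first \<open>m\<close>
  columns to the later ones. The trivial cuts 0 and \<open>diagram_order \<pi>\<close> are included,
  so irreducibility concerns the cuts strictly between them.\<close>

definition splits :: "nat \<Rightarrow> diagram \<Rightarrow> bool" where
  "splits m \<pi> \<longleftrightarrow> m \<le> diagram_order \<pi> \<and>
     (\<forall>B\<in>blocks \<pi>. B \<subseteq> vertices m \<or> B \<inter> vertices m = {})"

lemma splits_add: "splits (diagram_order a) (a + b)"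
proof -
  have "shift (diagram_order a) ` B \<inter> vertices (diagram_order a) = {}" if "B \<in> blocks b" for B
    using block_subset[OF that] vertices_shift_disjoint[of "diagram_order a" "diagram_order b"] by blast
  then show ?thesis
    using block_subset[of _ a] by (auto simp: splits_def blocks_add)
qed

text \<open>At a cut every block lies wholly on one side. The blocks on the left form
  \<open>a\<close>; those on the right, moved back by \<open>m\<close> columns, form
  \<open>b\<close>.\<close>

lemma splitsE:
  assumes "splits m \<pi>"
  obtains a b where "\<pi> = a + b" "diagram_order a = m"
proof -
  define l where "l = diagram_order \<pi> - m"
  have order: "diagram_order \<pi> = m + l" using assms by (simp add: l_def splits_def)
  have split: "B \<subseteq> vertices m \<or> B \<subseteq> shift m ` vertices l" if "B \<in> blocks \<pi>" for B
    using assms block_subset[OF that] that vertices_add[of m l] order unfolding splits_def by auto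
  have disj: "vertices m \<inter> shift m ` vertices l = {}" by (rule vertices_shift_disjoint)
  let ?P = "{B \<in> blocks \<pi>. B \<subseteq> vertices m}"
  let ?R = "{B \<in> blocks \<pi>. B \<subseteq> shift m ` vertices l}"
  let ?Q = "{B. shift m ` B \<in> blocks \<pi> \<and> B \<noteq> {} \<and> B \<subseteq> vertices l}"
  have dis: "disjoint (blocks \<pi>)" and ne: "{} \<notin> blocks \<pi>"
    using partition_onD2[OF partition_on_blocks] partition_onD3[OF partition_on_blocks] .
  have union: "\<Union>(blocks \<pi>) = vertices m \<union> shift m ` vertices l"
    by (simp add: Union_blocks order vertices_add)
  have "partition_on (vertices m) ?P"
  proof (rule partition_onI)
    show "\<Union>?P = vertices m"
    proof (intro equalityI subsetI)
      fix v assume v: "v \<in> vertices m"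
      then obtain B where B: "B \<in> blocks \<pi>" "v \<in> B" using union by blast
      then have "B \<subseteq> vertices m" using split[OF B(1)] disj v by blast
      then show "v \<in> \<Union>?P" using B by blast
    qed auto
    show "disjnt p q" if "p \<in> ?P" "q \<in> ?P" "p \<noteq> q" for p q
      using dis that unfolding pairwise_def by simp
    show "{} \<notin> ?P" using ne by simp
  qed
  then obtain a where a: "blocks a = ?P" "diagram_order a = m" using exists_diagram by blast
  \<comment> \<open>A set of vertices beyond column \<open>m\<close> is the shift of some set, so
    pulling blocks back and shifting them again loses none.\<close>
  have R: "(`) (shift m) ` ?Q = ?R"
  proof
    show "(`) (shift m) ` ?Q \<subseteq> ?R" by (intro image_subsetI CollectI conjI image_mono) auto
    show "?R \<subseteq> (`) (shift m) ` ?Q"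
    proof
      fix B assume B: "B \<in> ?R"
      then obtain C where C: "C \<subseteq> vertices l" "B = shift m ` C" using subset_imageE by blast
      moreover have "C \<noteq> {}" using B C(2) ne by force
      ultimately have "C \<in> ?Q" using B by simp
      then show "B \<in> (`) (shift m) ` ?Q" unfolding C by (rule imageI)
    qed
  qed
  have "partition_on (vertices l) ?Q"
  proof (rule partition_onI)
    show "\<Union>?Q = vertices l"
    proof (intro equalityI subsetI)
      fix v assume v: "v \<in> vertices l"
      then obtain B where B: "B \<in> blocks \<pi>" "shift m v \<in> B" using union by blast
      then have "B \<in> ?R" using split[OF B(1)] disj v by blast
      then have "B \<in> (`) (shift m) ` ?Q" by (simp only: R)
      then obtain C where C: "C \<in> ?Q" "B = shift m ` C" by (rule imageE)
      then have "v \<in> C" using B inj_image_mem_iff[OF inj_shift] by metis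
      then show "v \<in> \<Union>?Q" using C by blast
    qed auto
    show "disjnt p q" if "p \<in> ?Q" "q \<in> ?Q" "p \<noteq> q" for p q
    proof -
      have "disjnt (shift m ` p) (shift m ` q)"
        using dis that inj_image_eq_iff[OF inj_shift] unfolding pairwise_def by simp
      then show ?thesis by (auto simp: disjnt_def)
    qed
  qed auto
  then obtain b where b: "blocks b = ?Q" using exists_diagram by blast
  have "blocks (a + b) = ?P \<union> ?R"
    using R by (simp only: blocks_add a b)
  also have "\<dots> = blocks \<pi>" using split by blast
  finally show ?thesis using that a blocks_inject by metis
qed

lemma add_cancel_order:
  assumes "a + b = c + d" "diagram_order a = diagram_order c"
  shows "a = c \<and> b = d"
proof -
  have "diagram_order b = diagram_order d"
    using assms by (metis add_left_cancel diagram_order_add)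
  then have "blocks a = blocks c" "blocks b = blocks d"
    using assms blocks_add_left[of a b] blocks_add_left[of c d] blocks_add_right[of b a] blocks_add_right[of d c]
    by simp_all
  then show ?thesis by (simp add: blocks_inject)
qed

text \<open>This is Levi's property of free monoids. The boundary of \<open>a\<close> is a cut of
  the common product; since the blocks of \<open>c\<close> are among the blocks of that product, it
  is also a cut of \<open>c\<close>.\<close>

lemma add_equidivisible:
  assumes eq: "a + b = c + d" and le: "diagram_order a \<le> diagram_order c"
  obtains e where "c = a + e" "b = e + d"
proof -
  have "splits (diagram_order a) c"
    using splits_add[of a b] le blocks_add_left[of c d] unfolding splits_def eq by auto
  then obtain a' e where *: "c = a' + e" "diagram_order a' = diagram_order a" by (rule splitsE)
  then have "a + b = a' + (e + d)" using eq by (simp add: add.assoc)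
  with * add_cancel_order that show ?thesis by metis
qed

lemma tensor_irreducible_iff_splits:
  "tensor_irreducible \<pi> \<longleftrightarrow> \<not> (\<exists>m. 0 < m \<and> m < diagram_order \<pi> \<and> splits m \<pi>)"
proof -
  have "\<exists>m. 0 < m \<and> m < diagram_order (a + b) \<and> splits m (a + b)" if "a \<noteq> 0" "b \<noteq> 0" for a b
    using that splits_add[of a b] by (intro exI[of _ "diagram_order a"]) (simp)
  moreover have "\<exists>a b. a \<noteq> 0 \<and> b \<noteq> 0 \<and> \<pi> = a + b" if m: "0 < m" "m < diagram_order \<pi>" "splits m \<pi>" for m
  proof -
    obtain a b where ab: "\<pi> = a + b" "diagram_order a = m" using m(3) by (rule splitsE)
    then have "a \<noteq> 0" "b \<noteq> 0" using m by auto
    with ab show ?thesis by blast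
  qed
  ultimately show ?thesis unfolding tensor_irreducible_def by blast
qed

section \<open>Unique factorization into irreducible diagrams\<close>

definition irreducibles :: "diagram set" where
  "irreducibles = {\<pi>. \<pi> \<noteq> 0 \<and> tensor_irreducible \<pi>}"

lemma irreducible_factorization:
  "\<exists>\<rho>s. set \<rho>s \<subseteq> irreducibles \<and> sum_list \<rho>s = \<pi>"
proof (induction "diagram_order \<pi>" arbitrary: \<pi> rule: less_induct)
  case less
  consider "\<pi> = 0" | "\<pi> \<in> irreducibles" | a b where "a \<noteq> 0" "b \<noteq> 0" "\<pi> = a + b"
    by (auto simp: irreducibles_def tensor_irreducible_def)
  then show ?case
  proof cases
    case 1
    then show ?thesis by (intro exI[of _ "[]"]) simp
  next
    case 2
    then show ?thesis by (intro exI[of _ "[\<pi>]"]) simp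
  next
    case 3
    then have "diagram_order a < diagram_order \<pi>" "diagram_order b < diagram_order \<pi>"
      by (simp_all)
    then obtain as bs where "set as \<subseteq> irreducibles" "sum_list as = a" "set bs \<subseteq> irreducibles" "sum_list bs = b"
      using less by metis
    then show ?thesis using 3 by (intro exI[of _ "as @ bs"]) simp
  qed
qed

text \<open>By equidivisibility, the head of smaller order divides the other head from the left.
  Both being irreducible, the heads agree, and cancellation passes to the tails.\<close>

lemma irreducible_factorization_unique:
  assumes "set \<rho>s \<subseteq> irreducibles" "set \<sigma>s \<subseteq> irreducibles" "sum_list \<rho>s = sum_list \<sigma>s"
  shows "\<rho>s = \<sigma>s"
  using assms
proof (induction \<rho>s arbitrary: \<sigma>s)
  case Nil
  then show ?case by (cases \<sigma>s) (auto simp: irreducibles_def dest: sym)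
next
  case (Cons g \<rho>s)
  then obtain h \<tau>s where \<sigma>s: "\<sigma>s = h # \<tau>s" by (cases \<sigma>s) (auto simp: irreducibles_def)
  have gh: "g \<in> irreducibles" "h \<in> irreducibles" using Cons.prems \<sigma>s by auto
  have eq: "g + sum_list \<rho>s = h + sum_list \<tau>s" using Cons.prems \<sigma>s by simp
  have left_divisor: "g = h" if div: "g \<in> irreducibles" "h \<in> irreducibles" "g + a = h + b"
      "diagram_order g \<le> diagram_order h" for g h a b
  proof -
    obtain e where "h = g + e" using add_equidivisible div(3,4) by blast
    then show ?thesis using div(1,2)
      by (cases "e = 0") (auto simp: irreducibles_def tensor_irreducible_def)
  qed
  have "g = h" using left_divisor[OF gh eq] left_divisor[OF gh(2,1) eq[symmetric]] by (metis nat_le_linear)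
  then have "sum_list \<rho>s = sum_list \<tau>s" using eq add_cancel_order by blast
  then show ?case using Cons \<sigma>s \<open>g = h\<close> by simp
qed

definition factors :: "diagram \<Rightarrow> diagram list" where
  "factors \<pi> = (THE \<rho>s. set \<rho>s \<subseteq> irreducibles \<and> sum_list \<rho>s = \<pi>)"

lemma factors_eq: "set \<rho>s \<subseteq> irreducibles \<Longrightarrow> factors (sum_list \<rho>s) = \<rho>s"
  unfolding factors_def by (rule the_equality) (auto intro: irreducible_factorization_unique)

lemma factors_irreducible: "g \<in> irreducibles \<Longrightarrow> factors g = [g]"
  using factors_eq[of "[g]"] by simp

lemma factors_zero: "factors 0 = []"
  using factors_eq[of "[]"] by simp

text \<open>Freeness in the form used later: \<open>factors\<close> is a monoid morphism to lists,
  so multiplying prescribed values along it gives an algebra morphism.\<close>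

lemma factors_add: "factors (a + b) = factors a @ factors b"
proof -
  obtain as bs where *: "set as \<subseteq> irreducibles" "a = sum_list as" "set bs \<subseteq> irreducibles" "b = sum_list bs"
    using irreducible_factorization by metis
  then show ?thesis using factors_eq[of "as @ bs"] factors_eq[of as] factors_eq[of bs] by simp
qed

lemma diagram_induct [case_names zero add]:
  assumes "P 0" and "\<And>g a. g \<in> irreducibles \<Longrightarrow> P a \<Longrightarrow> P (g + a)"
  shows "P \<pi>"
proof -
  obtain \<rho>s where "set \<rho>s \<subseteq> irreducibles" "sum_list \<rho>s = \<pi>" using irreducible_factorization by blast
  then show ?thesis using assms by (induction \<rho>s arbitrary: \<pi>) auto
qed


section \<open>The product by merging\<close>

text \<open>Separating the merge from the tensor product reduces the laws of
  \<open>\<bullet>\<close> to the laws of \<open>+\<close> and the commutation of merges. If neither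
  vertex were present, \<open>merge_blocks\<close> would add an empty block; the guard excludes
  this.\<close>

lift_definition join_at :: "nat \<Rightarrow> diagram \<Rightarrow> diagram" is
  "\<lambda>n P. if 0 < n \<and> n < block_order P then merge_blocks (Prime n) (Prime (n + 1)) P else P"
proof -
  fix n :: nat and P :: "vertex set set"
  assume "\<exists>k. partition_on (vertices k) P"
  then obtain k where P: "partition_on (vertices k) P" by blast
  have "partition_on (vertices k) (merge_blocks (Prime n) (Prime (n + 1)) P)" if "0 < n \<and> n < block_order P"
    using that block_order_eq[OF P] by (intro partition_on_merge_blocks[OF P]) auto
  then show "\<exists>k. partition_on (vertices k)
      (if 0 < n \<and> n < block_order P then merge_blocks (Prime n) (Prime (n + 1)) P else P)"
    using P by (cases "0 < n \<and> n < block_order P") auto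
qed

lemma blocks_join_at:
  assumes "0 < n" "n < diagram_order \<pi>"
  shows "blocks (join_at n \<pi>) = merge_blocks (Prime n) (Prime (n + 1)) (blocks \<pi>)"
  using assms by (simp add: join_at.rep_eq diagram_order_def)

lemma diagram_order_join_at [simp]: "diagram_order (join_at n \<pi>) = diagram_order \<pi>"
proof (rule diagram_order_eq)
  show "partition_on (vertices (diagram_order \<pi>)) (blocks (join_at n \<pi>))"
    using partition_on_merge_blocks[OF partition_on_blocks, of "Prime n" \<pi> "Prime (n + 1)"] partition_on_blocks[of \<pi>]
    by (auto simp: join_at.rep_eq diagram_order_def[symmetric])
qed

lemma bullet_zero [simp]: "0 \<bullet> a = a" "a \<bullet> 0 = a"
proof -
  show "0 \<bullet> a = a" by transfer simp
  show "a \<bullet> 0 = a" by transfer simp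
qed

lemma bullet_eq_join_at:
  assumes "a \<noteq> 0" "b \<noteq> 0"
  shows "a \<bullet> b = join_at (diagram_order a) (a + b)"
proof -
  have "blocks a \<noteq> {}" "blocks b \<noteq> {}"
    using assms by (simp_all flip: blocks_inject add: zero_diagram.rep_eq)
  then have "blocks (a \<bullet> b) = merge_blocks (Prime (diagram_order a)) (Prime (diagram_order a + 1)) (blocks (a + b))"
    by (simp add: bullet.rep_eq plus_diagram.rep_eq diagram_order_def)
  also have "\<dots> = blocks (join_at (diagram_order a) (a + b))"
    using assms by (subst blocks_join_at) (auto)
  finally show ?thesis by (simp add: blocks_inject)
qed

lemma diagram_order_bullet [simp]: "diagram_order (a \<bullet> b) = diagram_order a + diagram_order b"
  by (cases "a = 0"; cases "b = 0") (simp_all add: bullet_eq_join_at)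

lemma bullet_eq_0_iff [simp]: "a \<bullet> b = 0 \<longleftrightarrow> a = 0 \<and> b = 0"
  by (simp flip: diagram_order_eq_0_iff)

lemma merge_blocks_Un:
  assumes "\<And>B. B \<in> R \<Longrightarrow> u \<notin> B \<and> v \<notin> B"
  shows "merge_blocks u v (P \<union> R) = merge_blocks u v P \<union> R"
proof -
  have "{B \<in> P \<union> R. u \<in> B \<or> v \<in> B} = {B \<in> P. u \<in> B \<or> v \<in> B}"
    "{B \<in> P \<union> R. u \<notin> B \<and> v \<notin> B} = {B \<in> P. u \<notin> B \<and> v \<notin> B} \<union> R"
    using assms by blast+
  then show ?thesis unfolding merge_blocks_def by (simp only:) blast
qed

lemma merge_blocks_image:
  assumes "inj f"
  shows "merge_blocks (f u) (f v) ((`) f ` Q) = (`) f ` merge_blocks u v Q"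
proof -
  have "{B \<in> (`) f ` Q. f u \<in> B \<or> f v \<in> B} = (`) f ` {B \<in> Q. u \<in> B \<or> v \<in> B}"
    "{B \<in> (`) f ` Q. f u \<notin> B \<and> f v \<notin> B} = (`) f ` {B \<in> Q. u \<notin> B \<and> v \<notin> B}"
    using inj_image_mem_iff[OF assms] by auto
  then show ?thesis unfolding merge_blocks_def by (simp only: image_Un image_insert image_empty image_Union)
qed

text \<open>Both merged vertices lie in columns of \<open>a\<close>, so no shifted block of
  \<open>b\<close> contains either of them.\<close>

lemma join_at_add_left:
  assumes "0 < n" "n < diagram_order a"
  shows "join_at n (a + b) = join_at n a + b"
proof -
  have "Prime i \<notin> shift (diagram_order a) ` B" if "B \<in> blocks b" "i \<le> diagram_order a" "0 < i" for B i
  proof -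
    have "Prime i \<in> vertices (diagram_order a)" using that by simp
    then show ?thesis
      using vertices_shift_disjoint[of "diagram_order a" "diagram_order b"] block_subset[OF that(1)] by blast
  qed
  then have "merge_blocks (Prime n) (Prime (n + 1)) (blocks a \<union> (`) (shift (diagram_order a)) ` blocks b)
      = merge_blocks (Prime n) (Prime (n + 1)) (blocks a) \<union> (`) (shift (diagram_order a)) ` blocks b"
    using assms by (intro merge_blocks_Un) (elim imageE, simp)
  then have "blocks (join_at n (a + b)) = blocks (join_at n a + b)"
    using assms by (subst blocks_join_at) (simp_all add: blocks_add blocks_join_at)
  then show ?thesis by (simp add: blocks_inject)
qed

lemma join_at_add_right:
  assumes "0 < n" "n < diagram_order b"
  shows "join_at (diagram_order a + n) (a + b) = a + join_at n b"
proof -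
  let ?k = "diagram_order a"
  have "Prime i \<notin> B" if "B \<in> blocks a" "?k < i" for B i
    using block_subset[OF that(1)] that(2) by fastforce
  then have "merge_blocks (Prime (?k + n)) (Prime (?k + n + 1)) ((`) (shift ?k) ` blocks b \<union> blocks a)
      = merge_blocks (Prime (?k + n)) (Prime (?k + n + 1)) ((`) (shift ?k) ` blocks b) \<union> blocks a"
    using assms(1) by (intro merge_blocks_Un) auto
  also have "\<dots> = (`) (shift ?k) ` merge_blocks (Prime n) (Prime (n + 1)) (blocks b) \<union> blocks a"
    using merge_blocks_image[OF inj_shift, of ?k "Prime n" "Prime (n + 1)" "blocks b"] by (simp add: add.commute)
  finally have "blocks (join_at (?k + n) (a + b)) = blocks (a + join_at n b)"
    using assms by (subst blocks_join_at) (auto simp: blocks_add blocks_join_at Un_commute)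
  then show ?thesis by (simp add: blocks_inject)
qed

text \<open>The same-block relation. Merging changes it by an explicit first-order formula, and a
  partition is determined by it, so equations between iterated merges become logical
  equivalences.\<close>

definition joined :: "vertex set set \<Rightarrow> vertex \<Rightarrow> vertex \<Rightarrow> bool" where
  "joined P x y \<longleftrightarrow> (\<exists>B\<in>P. x \<in> B \<and> y \<in> B)"

lemma joined_merge_blocks:
  "joined (merge_blocks u v P) x y \<longleftrightarrow>
     joined P x y \<or> (joined P x u \<or> joined P x v) \<and> (joined P y u \<or> joined P y v)"
proof
  assume "joined (merge_blocks u v P) x y"
  then obtain B where "B \<in> merge_blocks u v P" "x \<in> B" "y \<in> B" unfolding joined_def by blast
  then show "joined P x y \<or> (joined P x u \<or> joined P x v) \<and> (joined P y u \<or> joined P y v)"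
    unfolding joined_def merge_blocks_def by blast
next
  assume *: "joined P x y \<or> (joined P x u \<or> joined P x v) \<and> (joined P y u \<or> joined P y v)"
  show "joined (merge_blocks u v P) x y"
  proof (cases "\<exists>B\<in>P. x \<in> B \<and> y \<in> B \<and> u \<notin> B \<and> v \<notin> B")
    case True
    then show ?thesis unfolding joined_def merge_blocks_def by blast
  next
    case False
    with * have "x \<in> \<Union>{B \<in> P. u \<in> B \<or> v \<in> B}" "y \<in> \<Union>{B \<in> P. u \<in> B \<or> v \<in> B}"
      unfolding joined_def by blast+
    then show ?thesis unfolding joined_def merge_blocks_def by blast
  qed
qed

lemma joined_sym: "joined P x y \<Longrightarrow> joined P y x"
  by (auto simp: joined_def)

lemma partition_on_same_block:
  assumes "partition_on A P" "B \<in> P" "C \<in> P" "x \<in> B" "x \<in> C"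
  shows "B = C"
  using disjointD[OF partition_onD2[OF assms(1)] assms(2,3)] assms(4,5) by blast

lemma joined_trans:
  assumes "partition_on A P" "joined P x y" "joined P y z"
  shows "joined P x z"
proof -
  obtain B C where BC: "B \<in> P" "x \<in> B" "y \<in> B" "C \<in> P" "y \<in> C" "z \<in> C"
    using assms(2,3) unfolding joined_def by blast
  then have "B = C" using partition_on_same_block[OF assms(1)] by simp
  then show ?thesis using BC unfolding joined_def by blast
qed

lemma partition_on_eq_joined:
  assumes "partition_on A P"
  shows "P = (\<lambda>x. {y. joined P x y}) ` A"
proof -
  have *: "{y. joined P x y} = B" if "B \<in> P" "x \<in> B" for B x
    using that partition_on_same_block[OF assms] unfolding joined_def by blast
  show ?thesis
  proof (intro equalityI subsetI)
    fix B assume B: "B \<in> P"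
    then obtain x where "x \<in> B" using partition_onD3[OF assms] by (metis ex_in_conv)
    moreover from this have "x \<in> A" using B partition_onD1[OF assms] by blast
    ultimately show "B \<in> (\<lambda>x. {y. joined P x y}) ` A" using *[OF B] by blast
  next
    fix B assume "B \<in> (\<lambda>x. {y. joined P x y}) ` A"
    then obtain x where x: "x \<in> A" "B = {y. joined P x y}" by blast
    then obtain C where "C \<in> P" "x \<in> C" using partition_onD1[OF assms] by blast
    then show "B \<in> P" using * x by simp
  qed
qed

text \<open>Expanding \<open>joined_merge_blocks\<close> twice on each side leaves two formulas over
  the original relation, which agree by its symmetry and transitivity.\<close>

lemma merge_blocks_commute:
  assumes P: "partition_on A P" and "u \<in> A" "w \<in> A"
  shows "merge_blocks u v (merge_blocks w x P) = merge_blocks w x (merge_blocks u v P)"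
proof -
  have "joined (merge_blocks u v (merge_blocks w x P)) y z = joined (merge_blocks w x (merge_blocks u v P)) y z" for y z
    unfolding joined_merge_blocks using joined_sym[of P] joined_trans[OF P] by blast
  then have "joined (merge_blocks u v (merge_blocks w x P)) = joined (merge_blocks w x (merge_blocks u v P))"
    by (intro ext)
  moreover have "partition_on A (merge_blocks u v (merge_blocks w x P))"
    "partition_on A (merge_blocks w x (merge_blocks u v P))"
    using assms by (intro partition_on_merge_blocks; simp)+
  ultimately show ?thesis
    using partition_on_eq_joined[of A "merge_blocks u v (merge_blocks w x P)"]
      partition_on_eq_joined[of A "merge_blocks w x (merge_blocks u v P)"] by simp
qed

lemma join_at_commute:
  assumes "0 < m" "m < diagram_order \<pi>" "0 < n" "n < diagram_order \<pi>"
  shows "join_at m (join_at n \<pi>) = join_at n (join_at m \<pi>)"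
proof -
  have "blocks (join_at m (join_at n \<pi>)) = blocks (join_at n (join_at m \<pi>))"
    using assms by (simp add: blocks_join_at merge_blocks_commute[OF partition_on_blocks])
  then show ?thesis by (simp add: blocks_inject)
qed

text \<open>The merge happens at the boundary inside \<open>b + c\<close>, away from
  \<open>a\<close>. For empty \<open>b\<close> it would instead join the last column of
  \<open>a\<close> to \<open>c\<close>.\<close>

lemma add_bullet:
  assumes "b \<noteq> 0"
  shows "(a + b) \<bullet> c = a + (b \<bullet> c)"
proof (cases "c = 0")
  case False
  then show ?thesis
    using assms join_at_add_right[of "diagram_order b" "b + c" a]
    by (simp add: bullet_eq_join_at add.assoc)
qed simp

lemma bullet_add:
  assumes "b \<noteq> 0"
  shows "a \<bullet> (b + c) = (a \<bullet> b) + c"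
proof (cases "a = 0")
  case False
  then show ?thesis
    using assms join_at_add_left[of "diagram_order a" "a + b" c]
    by (simp add: bullet_eq_join_at add.assoc)
qed simp

text \<open>For nonempty factors, both sides are \<open>a + b + c\<close> with its two inner
  boundaries joined, in either order; these joins commute.\<close>

lemma bullet_assoc: "(a \<bullet> b) \<bullet> c = a \<bullet> (b \<bullet> c)"
proof (cases "a = 0 \<or> b = 0 \<or> c = 0")
  case False
  then have pos: "0 < diagram_order a" "0 < diagram_order b" "0 < diagram_order c"
    and ne: "a \<noteq> 0" "b \<noteq> 0" "c \<noteq> 0"
    by (auto)
  have "(a \<bullet> b) \<bullet> c = join_at (diagram_order a + diagram_order b) ((a \<bullet> b) + c)"
    using ne by (subst bullet_eq_join_at) auto
  also have "\<dots> = join_at (diagram_order a + diagram_order b) (join_at (diagram_order a) (a + b + c))"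
    using pos ne by (simp add: bullet_eq_join_at join_at_add_left)
  also have "\<dots> = join_at (diagram_order a) (join_at (diagram_order a + diagram_order b) (a + (b + c)))"
    using pos by (subst join_at_commute) (auto simp: add.assoc)
  also have "\<dots> = join_at (diagram_order a) (a + (b \<bullet> c))"
    using pos ne by (simp add: bullet_eq_join_at join_at_add_right)
  also have "\<dots> = a \<bullet> (b \<bullet> c)"
    using ne by (subst (2) bullet_eq_join_at) auto
  finally show ?thesis .
qed auto

text \<open>Merging only enlarges blocks, so it creates no cut. It destroys the cut at
  \<open>n\<close>, because the merged block contains vertices of both columns \<open>n\<close> and
  \<open>n + 1\<close>.\<close>

lemma splits_join_at:
  assumes "0 < n" "n < diagram_order \<pi>" "splits m (join_at n \<pi>)"
  shows "m \<noteq> n \<and> splits m \<pi>"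
proof
  let ?M = "merge_blocks (Prime n) (Prime (n + 1)) (blocks \<pi>)"
  have split: "B \<subseteq> vertices m \<or> B \<inter> vertices m = {}" if "B \<in> ?M" for B
    using assms that by (simp add: splits_def blocks_join_at)
  have "\<exists>C\<in>?M. B \<subseteq> C" if "B \<in> blocks \<pi>" for B
    using that unfolding merge_blocks_def by blast
  then have "B \<subseteq> vertices m \<or> B \<inter> vertices m = {}" if "B \<in> blocks \<pi>" for B
    using split that by (meson disjoint_iff subset_iff)
  then show "splits m \<pi>"
    using assms(3) by (simp add: splits_def)
  show "m \<noteq> n"
  proof
    assume "m = n"
    let ?C = "\<Union>{B \<in> blocks \<pi>. Prime n \<in> B \<or> Prime (n + 1) \<in> B}"
    have "Prime n \<in> \<Union>(blocks \<pi>)" "Prime (n + 1) \<in> \<Union>(blocks \<pi>)"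
      using assms(1,2) unfolding Union_blocks by simp_all
    then have C: "Prime n \<in> ?C"
      "Prime (n + 1) \<in> ?C" by blast+
    have "?C \<in> ?M" by (simp add: merge_blocks_def)
    moreover have "Prime n \<in> vertices m" "Prime (n + 1) \<notin> vertices m"
      using assms(1) \<open>m = n\<close> by simp_all
    ultimately show False using split[of ?C] C by blast
  qed
qed

text \<open>A decomposition of either factor survives in \<open>a \<bullet> b\<close> by
  \<open>add_bullet\<close> or \<open>bullet_add\<close>. Conversely, a proper cut of
  \<open>a \<bullet> b\<close> is a cut of \<open>a + b\<close> away from the boundary, and so
  restricts to a proper cut of \<open>a\<close> or of \<open>b\<close>.\<close>

lemma bullet_irreducibles_iff:
  assumes "a \<noteq> 0" "b \<noteq> 0"
  shows "a \<bullet> b \<in> irreducibles \<longleftrightarrow> a \<in> irreducibles \<and> b \<in> irreducibles"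
proof
  assume irr: "a \<bullet> b \<in> irreducibles"
  have "a \<bullet> b \<noteq> c + d" if "c \<noteq> 0" "d \<noteq> 0" for c d
    using irr that by (auto simp: irreducibles_def tensor_irreducible_def)
  note indecomposable = this
  have "a \<noteq> c + d" if "c \<noteq> 0" "d \<noteq> 0" for c d
    using indecomposable[of c "d \<bullet> b"] that add_bullet[of d c b] by auto
  moreover have "b \<noteq> c + d" if "c \<noteq> 0" "d \<noteq> 0" for c d
    using indecomposable[of "a \<bullet> c" d] that bullet_add[of c a d] by auto
  ultimately show "a \<in> irreducibles \<and> b \<in> irreducibles"
    using assms by (auto simp: irreducibles_def tensor_irreducible_def)
next
  assume irr: "a \<in> irreducibles \<and> b \<in> irreducibles"
  let ?k = "diagram_order a" and ?l = "diagram_order b"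
  have False if m: "0 < m" "m < ?k + ?l" "splits m (a \<bullet> b)" for m
  proof -
    have "m \<noteq> ?k" and split: "splits m (a + b)"
      using splits_join_at[of ?k "a + b" m] m assms by (auto simp: bullet_eq_join_at)
    then consider "m < ?k" | "?k < m" by linarith
    then show False
    proof cases
      case 1
      then have "splits m a" using split by (auto simp: splits_def blocks_add)
      then show False using 1 m irr by (auto simp: irreducibles_def tensor_irreducible_iff_splits)
    next
      case 2
      define n where "n = m - ?k"
      have n: "m = ?k + n" "0 < n" "n < ?l" using 2 m(2) by (auto simp: n_def)
      have "B \<subseteq> vertices n \<or> B \<inter> vertices n = {}" if B: "B \<in> blocks b" for B
      proof -
        have "shift ?k ` B \<in> blocks (a + b)" using B by (simp add: blocks_add)
        then have "shift ?k ` B \<subseteq> vertices m \<or> shift ?k ` B \<inter> vertices m = {}"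
          using split by (simp add: splits_def)
        moreover have "shift ?k ` B \<inter> vertices ?k = {}"
          using block_subset[OF B] vertices_shift_disjoint[of ?k ?l] by blast
        \<comment> \<open>The shifted block avoids the first \<open>?k\<close> columns, so only the
          \<open>n\<close> columns after them decide on which side of the cut it lies.\<close>
        ultimately have "shift ?k ` B \<subseteq> shift ?k ` vertices n \<or> shift ?k ` B \<inter> shift ?k ` vertices n = {}"
          unfolding n(1) vertices_add by blast
        then show ?thesis by (auto simp: inj_image_subset_iff[OF inj_shift] simp flip: image_Int[OF inj_shift])
      qed
      then have "splits n b" using n by (simp add: splits_def)
      then show False using n irr by (auto simp: irreducibles_def tensor_irreducible_iff_splits)
    qed
  qed
  then show "a \<bullet> b \<in> irreducibles"
    using assms by (auto simp: irreducibles_def tensor_irreducible_iff_splits)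
qed


section \<open>Linear maps given on a basis\<close>

abbreviation lin :: "(('a \<Rightarrow>\<^sub>0 'k::field) \<Rightarrow> ('b \<Rightarrow>\<^sub>0 'k)) \<Rightarrow> bool" where
  "lin \<equiv> Vector_Spaces.linear scale scale"

lemma linI:
  assumes "\<And>x y. F (x + y) = F x + F y" "\<And>c x. F (scale c x) = scale c (F x)"
  shows "lin F"
  by (simp add: Vector_Spaces.linear_iff vector_space_scale assms)

lemma lin_add: "lin F \<Longrightarrow> F (x + y) = F x + F y"
  by (simp add: Vector_Spaces.linear_iff)

lemma lin_scale: "lin F \<Longrightarrow> F (scale c x) = scale c (F x)"
  by (simp add: Vector_Spaces.linear_iff)

lemma scale_simps:
  "scale c (x + y) = scale c x + scale c y" "scale (c + d) x = scale c x + scale d x"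
  "scale c (scale d x) = scale (c * d) x" "scale 1 x = x" "scale 0 x = 0" "scale c 0 = 0"
  by (rule poly_mapping_eqI; simp add: lookup_add algebra_simps)+

lemma scale_sum: "scale c (sum f A) = (\<Sum>a\<in>A. scale c (f a))"
  by (rule poly_mapping_eqI) (simp add: lookup_sum sum_distrib_left)

lemma lin_zero:
  assumes "lin F"
  shows "F 0 = 0"
  using lin_scale[OF assms, of 0 0] by (simp add: scale_simps)

lemma lin_sum:
  assumes "lin F"
  shows "F (sum f A) = (\<Sum>a\<in>A. F (f a))"
  by (induction A rule: infinite_finite_induct) (simp_all add: lin_zero[OF assms] lin_add[OF assms])

lemma basis_expansion: "x = (\<Sum>a\<in>Poly_Mapping.keys x. scale (Poly_Mapping.lookup x a) (H a))"
proof (rule poly_mapping_eqI)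
  fix b
  have "(\<Sum>a\<in>Poly_Mapping.keys x. Poly_Mapping.lookup x a * Poly_Mapping.lookup (H a) b)
      = (\<Sum>a\<in>Poly_Mapping.keys x. if a = b then Poly_Mapping.lookup x b else 0)"
    by (intro sum.cong) (auto simp: lookup_single when_def)
  also have "\<dots> = Poly_Mapping.lookup x b"
    by (simp add: in_keys_iff)
  finally show "Poly_Mapping.lookup x b
      = Poly_Mapping.lookup (\<Sum>a\<in>Poly_Mapping.keys x. scale (Poly_Mapping.lookup x a) (H a)) b"
    by (simp add: lookup_sum)
qed

lemma lin_eqI:
  assumes "lin F" "lin G" "\<And>a. F (H a) = G (H a)"
  shows "F x = G x"
proof -
  have "F x = (\<Sum>a\<in>Poly_Mapping.keys x. scale (Poly_Mapping.lookup x a) (F (H a)))"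
    by (subst basis_expansion) (simp add: lin_sum[OF assms(1)] lin_scale[OF assms(1)])
  also have "\<dots> = G x"
    by (subst (3) basis_expansion) (simp add: assms(3) lin_sum[OF assms(2)] lin_scale[OF assms(2)])
  finally show ?thesis .
qed

text \<open>Sums for vectors with different supports can be compared only over a common index set;
  this is what additivity of \<open>lin_ext\<close> requires.\<close>

lemma lin_ext_superset:
  assumes "finite A" "Poly_Mapping.keys x \<subseteq> A"
  shows "lin_ext f x = (\<Sum>a\<in>A. scale (Poly_Mapping.lookup x a) (f a))"
  unfolding lin_ext_def
  by (rule sum.mono_neutral_left) (use assms in \<open>auto simp: in_keys_iff scale_simps\<close>)

lemma lin_ext_H [simp]: "lin_ext f (H a) = f a"
  by (simp add: lin_ext_def scale_simps)

lemma lin_lin_ext: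
  fixes f :: "'a \<Rightarrow> ('b \<Rightarrow>\<^sub>0 'k::field)"
  shows "lin (lin_ext f)"
proof (rule linI)
  fix x y :: "'a \<Rightarrow>\<^sub>0 'k" and c :: 'k
  let ?A = "Poly_Mapping.keys x \<union> Poly_Mapping.keys y"
  have "lin_ext f (x + y) = (\<Sum>a\<in>?A. scale (Poly_Mapping.lookup (x + y) a) (f a))"
    using Poly_Mapping.keys_add[of x y] by (intro lin_ext_superset) auto
  also have "\<dots> = lin_ext f x + lin_ext f y"
    by (simp add: lin_ext_superset[of ?A] lookup_add scale_simps sum.distrib)
  finally show "lin_ext f (x + y) = lin_ext f x + lin_ext f y" .
  have "lin_ext f (scale c x) = (\<Sum>a\<in>Poly_Mapping.keys x. scale (Poly_Mapping.lookup (scale c x) a) (f a))"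
    by (intro lin_ext_superset) (auto simp: in_keys_iff)
  also have "\<dots> = scale c (lin_ext f x)"
    by (simp add: lin_ext_def scale_sum scale_simps)
  finally show "lin_ext f (scale c x) = scale c (lin_ext f x)" .
qed

lemma lin_ident: "lin (\<lambda>x. x)"
  by (rule linI) simp_all

lemma lin_id: "lin id"
  by (rule linI) simp_all

lemma lin_comp:
  assumes "lin F" "lin G"
  shows "lin (\<lambda>x. F (G x))"
  using assms by (intro linI) (simp_all add: lin_add lin_scale)

section \<open>Bilinearity of products and tensors\<close>

lemma scale_mult_left: "scale c x * y = scale c (x * y :: 'a::monoid_add \<Rightarrow>\<^sub>0 'k::field)"
  unfolding scale_def mult_map_scale_conv_mult by (simp add: mult.assoc)

text \<open>Scaling by \<open>c\<close> is left multiplication by \<open>single 0 c\<close>. The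
  basis monoid need not be commutative, but this element is central, which is checked on basis
  vectors.\<close>

lemma scale_mult_right: "x * scale c y = scale c (x * y :: 'a::monoid_add \<Rightarrow>\<^sub>0 'k::field)"
proof -
  have "lin (\<lambda>x. x * Poly_Mapping.single (0::'a) c)" "lin (\<lambda>x. Poly_Mapping.single (0::'a) c * x)"
  proof -
    show "lin (\<lambda>x. x * Poly_Mapping.single (0::'a) c)"
      by (rule linI) (simp_all add: distrib_right scale_mult_left)
    have "Poly_Mapping.single (0::'a) c * x = scale c x" for x
      by (simp add: scale_def mult_map_scale_conv_mult)
    then show "lin (\<lambda>x. Poly_Mapping.single (0::'a) c * x)"
      by (intro linI) (simp_all add: scale_simps mult.commute)
  qed
  then have "x * Poly_Mapping.single 0 c = Poly_Mapping.single 0 c * x"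
    by (rule lin_eqI) (simp add: mult_single)
  then show ?thesis
    unfolding scale_def mult_map_scale_conv_mult by (metis mult.assoc)
qed

lemma lin_scale_left: "lin F \<Longrightarrow> lin (\<lambda>x. scale c (F x))"
  by (rule linI) (simp_all add: lin_add lin_scale scale_simps mult.commute)

lemma lin_mult_left:
  fixes F :: "('a \<Rightarrow>\<^sub>0 'k::field) \<Rightarrow> ('b::monoid_add \<Rightarrow>\<^sub>0 'k)"
  shows "lin F \<Longrightarrow> lin (\<lambda>x. F x * y)"
  by (rule linI) (simp_all add: lin_add lin_scale distrib_right scale_mult_left)

lemma lin_mult_right:
  fixes F :: "('a \<Rightarrow>\<^sub>0 'k::field) \<Rightarrow> ('b::monoid_add \<Rightarrow>\<^sub>0 'k)"
  shows "lin F \<Longrightarrow> lin (\<lambda>x. y * F x)"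
  by (rule linI) (simp_all add: lin_add lin_scale distrib_left scale_mult_right)

lemma lin_tensor_left: "lin F \<Longrightarrow> lin (\<lambda>x. tensor (F x) y)"
  unfolding tensor_def by (rule lin_comp[OF lin_lin_ext])

lemma lin_tensor_right: "lin F \<Longrightarrow> lin (\<lambda>y. tensor x (F y))"
  unfolding tensor_def lin_ext_def[of _ x]
  by (rule linI)
    (simp_all add: lin_add lin_scale lin_add[OF lin_lin_ext] lin_scale[OF lin_lin_ext] scale_simps sum.distrib
      scale_sum mult.commute)

lemma lin_tensor_map: "lin (tensor_map f g)"
  unfolding tensor_map_def by (rule lin_lin_ext)

lemma lin_tensor_assoc: "lin tensor_assoc"
  unfolding tensor_assoc_def by (rule lin_lin_ext)

lemma lin_tensor_middle_swap: "lin tensor_middle_swap"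
  unfolding tensor_middle_swap_def by (rule lin_lin_ext)

lemma lin_nabla: "lin nabla"
  unfolding nabla_def by (rule lin_lin_ext)

lemmas lin_intros = lin_ident lin_id lin_lin_ext lin_tensor_map lin_tensor_assoc lin_tensor_middle_swap lin_nabla
  lin_scale_left lin_mult_left lin_mult_right lin_tensor_left lin_tensor_right
  lin_comp[OF lin_lin_ext] lin_comp[OF lin_tensor_map] lin_comp[OF lin_tensor_assoc]
  lin_comp[OF lin_tensor_middle_swap] lin_comp[OF lin_nabla]

lemma tensor_map_H [simp]: "tensor_map f g (H (a, b)) = tensor (f (H a)) (g (H b))"
  by (simp add: tensor_map_def)

lemma bilinear_eqI:
  assumes "\<And>y. lin (\<lambda>x. F x y)" "\<And>x. lin (\<lambda>y. F x y)" "\<And>y. lin (\<lambda>x. G x y)" "\<And>x. lin (\<lambda>y. G x y)"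
    and "\<And>a b. F (H a) (H b) = G (H a) (H b)"
  shows "F x y = G x y"
proof (rule lin_eqI[of "\<lambda>x. F x y" "\<lambda>x. G x y"])
  show "F (H a) y = G (H a) y" for a
    by (rule lin_eqI[of "F (H a)" "G (H a)"]) (use assms in auto)
qed (use assms in auto)

lemma nabla_H [simp]: "nabla (H (a, b)) = H (a + b)"
  by (simp add: nabla_def mult_single)

lemma nabla_tensor: "nabla (tensor x y) = x * y"
  by (rule bilinear_eqI[of "\<lambda>x y. nabla (tensor x y)" "\<lambda>x y. x * y"])
    (auto intro!: lin_intros simp: tensor_H_H mult_single)

text \<open>By bilinearity in both pairs of arguments it suffices to look at basis vectors, where
  both sides add indices componentwise. This identifies convolution over pairs with the product of
  the tensor square.\<close>

lemma tensor_mult_tensor: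
  fixes x x' :: "'a::monoid_add \<Rightarrow>\<^sub>0 'k::field" and y y' :: "'b::monoid_add \<Rightarrow>\<^sub>0 'k"
  shows "tensor x y * tensor x' y' = tensor (x * x') (y * y')"
proof (rule bilinear_eqI[of "\<lambda>x y. tensor x y * tensor x' y'" "\<lambda>x y. tensor (x * x') (y * y')"])
  show "tensor (H a) (H b) * tensor x' y' = tensor (H a * x') (H b * y')" for a b
    by (rule bilinear_eqI[of "\<lambda>x' y'. tensor (H a) (H b) * tensor x' y'" "\<lambda>x' y'. tensor (H a * x') (H b * y')"])
      (auto intro!: lin_intros simp: tensor_H_H mult_single)
qed (auto intro!: lin_intros)

section \<open>Multiplicative maps and comparison on generators\<close>

definition multiplicative :: "(('a::monoid_add \<Rightarrow>\<^sub>0 'k::field) \<Rightarrow> ('b::monoid_add \<Rightarrow>\<^sub>0 'k)) \<Rightarrow> bool" where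
  "multiplicative F \<longleftrightarrow> (\<forall>x y. F (x * y) = F x * F y)"

lemma multiplicativeI:
  assumes "lin F" "\<And>a b. F (H (a + b)) = F (H a) * F (H b)"
  shows "multiplicative F"
  unfolding multiplicative_def
proof (intro allI)
  show "F (x * y) = F x * F y" for x y
    by (rule bilinear_eqI[of "\<lambda>x y. F (x * y)" "\<lambda>x y. F x * F y"])
      (auto intro!: lin_intros lin_comp[OF assms(1)] assms(1) simp: mult_single assms(2))
qed

lemma antimultiplicativeI:
  fixes F :: "('a::monoid_add \<Rightarrow>\<^sub>0 'k::field) \<Rightarrow> ('b::monoid_add \<Rightarrow>\<^sub>0 'k)"
  assumes "lin F" "\<And>a b. F (H (a + b)) = F (H b) * F (H a)"
  shows "F (x * y) = F y * F x"
  by (rule bilinear_eqI[of "\<lambda>x y. F (x * y)" "\<lambda>x y. F y * F x"])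
    (auto intro!: lin_intros lin_comp[OF assms(1)] assms(1) simp: mult_single assms(2))

lemma multiplicativeD: "multiplicative F \<Longrightarrow> F (x * y) = F x * F y"
  by (simp add: multiplicative_def)

lemma multiplicative_comp: "multiplicative F \<Longrightarrow> multiplicative G \<Longrightarrow> multiplicative (\<lambda>x. F (G x))"
  by (simp add: multiplicative_def)

lemma multiplicative_id: "multiplicative id"
  by (simp add: multiplicative_def)

lemma H_add: "H (a + b) = (H a * H b :: 'a::monoid_add \<Rightarrow>\<^sub>0 'k::field)"
  by (simp add: mult_single)

lemma multiplicative_tensor_map:
  assumes "multiplicative F" "multiplicative G"
  shows "multiplicative (tensor_map F G)"
proof (rule multiplicativeI[OF lin_tensor_map])
  show "tensor_map F G (H (p + q)) = tensor_map F G (H p) * tensor_map F G (H q)" for p q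
    by (cases p; cases q) (simp add: H_add multiplicativeD[OF assms(1)] multiplicativeD[OF assms(2)]
      tensor_mult_tensor del: mult_single)
qed

lemma multiplicative_tensor_assoc:
  "multiplicative (tensor_assoc :: (('a::monoid_add \<times> 'b::monoid_add) \<times> 'c::monoid_add \<Rightarrow>\<^sub>0 'k::field) \<Rightarrow> _)"
proof (rule multiplicativeI[OF lin_tensor_assoc])
  show "tensor_assoc (H (p + q)) = tensor_assoc (H p) * (tensor_assoc (H q) :: 'a \<times> 'b \<times> 'c \<Rightarrow>\<^sub>0 'k)"
    for p q :: "('a \<times> 'b) \<times> 'c"
    by (cases p; cases "fst p"; cases q; cases "fst q") (simp add: tensor_assoc_def mult_single)
qed

text \<open>Induction peels off the leftmost irreducible factor. This form serves maps whose
  multiplicativity is not at hand: antimorphisms, and the two convolutions of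
  \<open>antipode_S\<close> with the identity.\<close>

lemma diagram_lin_eqI:
  assumes "lin F" "lin G" "F (H 0) = G (H 0)"
    and "\<And>g a. g \<in> irreducibles \<Longrightarrow> F (H a) = G (H a) \<Longrightarrow> F (H (g + a)) = G (H (g + a))"
  shows "F x = G x"
proof (rule lin_eqI[OF assms(1,2)])
  show "F (H a) = G (H a)" for a
    by (induction a rule: diagram_induct) (use assms in auto)
qed

text \<open>\<open>multiplicative\<close> says nothing about the unit, hence the separate premise at
  \<open>H 0\<close>.\<close>

lemma diagram_multiplicative_eqI:
  assumes "lin F" "lin G" "multiplicative F" "multiplicative G" "F (H 0) = G (H 0)"
    and "\<And>g. g \<in> irreducibles \<Longrightarrow> F (H g) = G (H g)"
  shows "F x = G x"
  by (rule diagram_lin_eqI[OF assms(1,2,5)])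
    (simp add: H_add multiplicativeD[OF assms(3)] multiplicativeD[OF assms(4)] assms(6) del: mult_single)


section \<open>The coproduct and the antipode\<close>

lemma finite_bullet_pairs: "finite {p. fst p \<bullet> snd p = \<pi>}"
proof (rule finite_subset)
  show "{p. fst p \<bullet> snd p = \<pi>} \<subseteq>
      {a. diagram_order a \<le> diagram_order \<pi>} \<times> {b. diagram_order b \<le> diagram_order \<pi>}"
    by auto
qed (simp add: finite_diagram_order_le)

lemma bullet_irreducibles:
  assumes "a \<bullet> b \<in> irreducibles"
  shows "a = 0 \<or> a \<in> irreducibles" "b = 0 \<or> b \<in> irreducibles"
  using assms bullet_irreducibles_iff[of a b] by (cases "a = 0"; cases "b = 0"; auto)+

text \<open>Factors of an irreducible diagram are empty or irreducible, so the side conditions in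
  \<open>bullet_pairs\<close> hold automatically. Coassociativity can then rely on associativity of
  \<open>\<bullet>\<close> alone.\<close>

lemma bullet_pairs_eq:
  assumes "\<pi> = 0 \<or> \<pi> \<in> irreducibles"
  shows "bullet_pairs \<pi> = {(a, b). a \<bullet> b = \<pi>}"
proof -
  have "(a = 0 \<or> tensor_irreducible a) \<and> (b = 0 \<or> tensor_irreducible b)" if "a \<bullet> b = \<pi>" for a b
  proof (cases "\<pi> = 0")
    case True
    then show ?thesis using that by auto
  next
    case False
    then have "a \<bullet> b \<in> irreducibles" using assms that by simp
    then show ?thesis using bullet_irreducibles[of a b] by (auto simp: irreducibles_def)
  qed
  then show ?thesis by (auto simp: bullet_pairs_def)
qed

text \<open>The existence half of the definite description: the values on generators are multiplied
  along the unique factorization.\<close>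

lemma is_coproduct_lin_ext:
  fixes f :: "diagram \<Rightarrow> (diagram \<times> diagram \<Rightarrow>\<^sub>0 'k::field)"
  defines "f \<equiv> \<lambda>g. \<Sum>(G1, G2)\<in>bullet_pairs g. tensor (H G1) (H G2)"
  shows "is_coproduct (lin_ext (\<lambda>\<pi>. prod_list (map f (factors \<pi>))))" (is "is_coproduct ?D")
  unfolding is_coproduct_def
proof (intro conjI allI impI)
  show lin: "lin ?D" by (rule lin_lin_ext)
  have "multiplicative ?D"
    by (rule multiplicativeI[OF lin]) (simp add: factors_add)
  then show "?D (x * y) = ?D x * ?D y" for x y by (rule multiplicativeD)
  \<comment> \<open>The empty product over \<open>factors 0\<close> is the algebra unit, which on
    pairs is the basis vector at \<open>(0, 0)\<close>.\<close>
  have "H (0, 0) = (1 :: diagram \<times> diagram \<Rightarrow>\<^sub>0 'k)"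
    unfolding zero_prod_def[symmetric] by (rule single_one)
  then show "?D (H 0) = tensor (H 0) (H 0)" by (simp only: lin_ext_H factors_zero tensor_H_H) simp
  show "?D (H \<pi>) = (\<Sum>(G1, G2)\<in>bullet_pairs \<pi>. tensor (H G1) (H G2))"
    if "\<pi> \<noteq> 0 \<and> tensor_irreducible \<pi>" for \<pi>
    using that by (simp add: factors_irreducible irreducibles_def f_def)
qed

lemma is_coproductD:
  assumes "is_coproduct D"
  shows "lin D" "multiplicative D" "D (H 0) = tensor (H 0) (H 0)"
    and "g \<in> irreducibles \<Longrightarrow> D (H g) = (\<Sum>(G1, G2)\<in>bullet_pairs g. tensor (H G1) (H G2))"
  using assms unfolding is_coproduct_def multiplicative_def irreducibles_def mem_Collect_eq by blast+

lemma is_coproduct_unique: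
  assumes D: "is_coproduct D" and D': "is_coproduct D'"
  shows "D = D'"
proof
  show "D x = D' x" for x
    by (rule diagram_multiplicative_eqI)
      (simp_all only: is_coproductD[OF D] is_coproductD[OF D'])
qed

lemma is_coproduct_Delta: "is_coproduct (Delta :: 'k::field parsym \<Rightarrow> _)"
  unfolding Delta_def
  by (rule theI[of is_coproduct]) (rule is_coproduct_lin_ext, rule is_coproduct_unique[OF _ is_coproduct_lin_ext])

text \<open>Reversing the factor list makes the extension an antimorphism, since \<open>rev\<close>
  swaps the two parts of \<open>factors a @ factors b\<close>.\<close>

lemma is_antimorphism_S_lin_ext:
  fixes f :: "diagram \<Rightarrow> 'k::field parsym"
  defines "f \<equiv> \<lambda>g. \<Sum>\<rho>s\<in>bullet_tuples g. scale ((-1) ^ length \<rho>s) (prod_list (map H \<rho>s))"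
  shows "is_antimorphism_S (lin_ext (\<lambda>\<pi>. prod_list (map f (rev (factors \<pi>)))))" (is "is_antimorphism_S ?S")
  unfolding is_antimorphism_S_def
proof (intro conjI allI impI)
  show lin: "lin ?S" by (rule lin_lin_ext)
  show "?S (x * y) = ?S y * ?S x" for x y
    by (rule antimultiplicativeI[OF lin]) (simp add: factors_add)
  show "?S (H 0) = H 0" by (simp only: lin_ext_H factors_zero) simp
  show "?S (H \<pi>) = (\<Sum>\<rho>s\<in>bullet_tuples \<pi>. scale ((-1) ^ length \<rho>s) (prod_list (map H \<rho>s)))"
    if "\<pi> \<noteq> 0 \<and> tensor_irreducible \<pi>" for \<pi>
    using that by (simp add: factors_irreducible irreducibles_def f_def)
qed

lemma is_antimorphism_SD:
  assumes "is_antimorphism_S S"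
  shows "lin S" "S (x * y) = S y * S x" "S (H 0) = H 0"
    and "g \<in> irreducibles \<Longrightarrow>
      S (H g) = (\<Sum>\<rho>s\<in>bullet_tuples g. scale ((-1) ^ length \<rho>s) (prod_list (map H \<rho>s)))"
  using assms unfolding is_antimorphism_S_def irreducibles_def mem_Collect_eq by blast+

lemma is_antimorphism_S_unique:
  assumes S: "is_antimorphism_S S" and S': "is_antimorphism_S S'"
  shows "S = S'"
proof
  show "S x = S' x" for x
    by (rule diagram_lin_eqI)
      (simp_all only: H_add is_antimorphism_SD[OF S] is_antimorphism_SD[OF S'])
qed

lemma is_antimorphism_S_antipode_S: "is_antimorphism_S (antipode_S :: 'k::field parsym \<Rightarrow> _)"
  unfolding antipode_S_def
  by (rule theI[of is_antimorphism_S]) (rule is_antimorphism_S_lin_ext, rule is_antimorphism_S_unique[OF _ is_antimorphism_S_lin_ext])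

lemmas lin_Delta = is_coproductD(1)[OF is_coproduct_Delta]
  and multiplicative_Delta = is_coproductD(2)[OF is_coproduct_Delta]

lemma Delta_zero: "Delta (H 0) = H (0, 0)"
  by (simp only: is_coproductD(3)[OF is_coproduct_Delta] tensor_H_H)

text \<open>Treating the empty diagram together with the irreducible ones allows
  \<open>Delta\<close> to be expanded again on either component of a term.\<close>

lemma Delta_H:
  assumes "\<pi> = 0 \<or> \<pi> \<in> irreducibles"
  shows "Delta (H \<pi>) = (\<Sum>p | fst p \<bullet> snd p = \<pi>. H p)"
proof (cases "\<pi> = 0")
  case True
  have "{p. fst p \<bullet> snd p = 0} = {(0, 0)}" by auto
  then show ?thesis unfolding True Delta_zero by simp
next
  case False
  have "{p. fst p \<bullet> snd p = \<pi>} = {(a, b). a \<bullet> b = \<pi>}" by auto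
  then show ?thesis
    using False assms
    by (simp add: is_coproductD(4)[OF is_coproduct_Delta] tensor_H_H bullet_pairs_eq[OF assms] case_prod_beta')
qed

lemmas lin_antipode_S = is_antimorphism_SD(1)[OF is_antimorphism_S_antipode_S]
  and antipode_S_mult = is_antimorphism_SD(2)[OF is_antimorphism_S_antipode_S]
  and antipode_S_zero = is_antimorphism_SD(3)[OF is_antimorphism_S_antipode_S]

text \<open>Unlike \<open>bullet_tuples\<close>, these include the empty tuple, which makes the formula for the
  antipode uniform in \<open>\<pi> = 0\<close> and \<open>\<pi>\<close> irreducible.\<close>

definition nonzero_tuples :: "diagram \<Rightarrow> diagram list set" where
  "nonzero_tuples \<pi> = {\<rho>s. 0 \<notin> set \<rho>s \<and> foldr (\<bullet>) \<rho>s 0 = \<pi>}"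

lemma diagram_order_foldr_bullet: "diagram_order (foldr (\<bullet>) \<rho>s 0) = (\<Sum>\<rho>\<leftarrow>\<rho>s. diagram_order \<rho>)"
  by (induction \<rho>s) simp_all

lemma foldr_bullet_append: "foldr (\<bullet>) \<rho>s 0 \<bullet> a = foldr (\<bullet>) \<rho>s a"
  by (induction \<rho>s) (simp_all add: bullet_assoc)

text \<open>Orders add under \<open>\<bullet>\<close>, and every nonempty entry has order at least
  1, so the order of \<pi> bounds both the length of a tuple and the order of its entries.\<close>

lemma finite_nonzero_tuples: "finite (nonzero_tuples \<pi>)"
proof (rule finite_subset)
  have "length \<rho>s \<le> (\<Sum>\<rho>\<leftarrow>\<rho>s. diagram_order \<rho>)" if "0 \<notin> set \<rho>s" for \<rho>s
    using that
  proof (induction \<rho>s)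
    case (Cons \<rho> \<rho>s)
    then have "1 \<le> diagram_order \<rho>" by (simp add: Suc_le_eq)
    moreover have "length \<rho>s \<le> (\<Sum>\<rho>\<leftarrow>\<rho>s. diagram_order \<rho>)" using Cons by simp
    ultimately show ?case by (simp only: list.size list.map sum_list.Cons)
  qed simp
  moreover have "diagram_order \<rho> \<le> (\<Sum>\<rho>\<leftarrow>\<rho>s. diagram_order \<rho>)" if "\<rho> \<in> set \<rho>s" for \<rho> \<rho>s
    using that by (intro member_le_sum_list) auto
  ultimately show "nonzero_tuples \<pi> \<subseteq>
      {\<rho>s. set \<rho>s \<subseteq> {\<rho>. diagram_order \<rho> \<le> diagram_order \<pi>} \<and> length \<rho>s \<le> diagram_order \<pi>}"
    unfolding nonzero_tuples_def diagram_order_foldr_bullet[symmetric] by blast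
  show "finite {\<rho>s. set \<rho>s \<subseteq> {\<rho>. diagram_order \<rho> \<le> diagram_order \<pi>} \<and> length \<rho>s \<le> diagram_order \<pi>}"
    by (rule finite_lists_length_le[OF finite_diagram_order_le])
qed

definition signed_H :: "diagram list \<Rightarrow> 'k::field parsym" where
  "signed_H \<rho>s = scale ((-1) ^ length \<rho>s) (prod_list (map H \<rho>s))"

lemma antipode_S_H:
  assumes "\<pi> = 0 \<or> \<pi> \<in> irreducibles"
  shows "antipode_S (H \<pi>) = (\<Sum>\<rho>s\<in>nonzero_tuples \<pi>. signed_H \<rho>s)"
proof (cases "\<pi> = 0")
  case True
  have "nonzero_tuples 0 = {[]}"
  proof (intro equalityI subsetI)
    show "\<rho>s \<in> {[]}" if "\<rho>s \<in> nonzero_tuples 0" for \<rho>s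
      using that by (cases \<rho>s) (auto simp: nonzero_tuples_def)
  qed (simp add: nonzero_tuples_def)
  then show ?thesis unfolding True antipode_S_zero by (simp add: signed_H_def scale_simps)
next
  case False
  have "bullet_tuples \<pi> = nonzero_tuples \<pi>"
    using False by (auto simp: bullet_tuples_def nonzero_tuples_def)
  then show ?thesis
    using False assms by (simp add: is_antimorphism_SD(4)[OF is_antimorphism_S_antipode_S] signed_H_def)
qed

lemma signed_H_Cons: "signed_H (\<rho> # \<rho>s) = - (H \<rho> * signed_H \<rho>s)"
  by (rule poly_mapping_eqI) (simp add: signed_H_def scale_mult_right)

lemma signed_H_snoc: "signed_H (\<rho>s @ [\<rho>]) = - (signed_H \<rho>s * H \<rho>)"
  by (rule poly_mapping_eqI) (simp add: signed_H_def scale_mult_left)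


section \<open>The Hopf algebra axioms\<close>

lemma epsilon_eq: "epsilon x = Poly_Mapping.lookup x 0"
proof -
  have "epsilon x = (\<Sum>\<pi>\<in>Poly_Mapping.keys x. if \<pi> = 0 then Poly_Mapping.lookup x 0 else 0)"
    unfolding epsilon_def by (intro sum.cong) auto
  also have "\<dots> = Poly_Mapping.lookup x 0" by (simp add: in_keys_iff)
  finally show ?thesis .
qed

lemma epsilon_H: "epsilon (H \<pi>) = (if \<pi> = 0 then 1 else 0)"
  by (simp add: epsilon_eq lookup_single when_def)

lemma epsilon_one: "epsilon 1 = 1"
  using epsilon_H[of 0] by simp

lemma lin_eta_epsilon: "lin (\<lambda>x. eta (epsilon x))"
  by (rule linI) (simp_all add: eta_def epsilon_eq lookup_add scale_simps)

lemma multiplicative_eta_epsilon: "multiplicative (\<lambda>x :: 'k::field parsym. eta (epsilon x))"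
proof (rule multiplicativeI[OF lin_eta_epsilon])
  show "eta (epsilon (H (a + b))) = eta (epsilon (H a)) * (eta (epsilon (H b)) :: 'k parsym)" for a b
    by (cases "a = 0"; cases "b = 0") (simp_all add: epsilon_H epsilon_one eta_def scale_simps)
qed

text \<open>Multiplicativity of \<open>eta\<close> after \<open>epsilon\<close> is already known;
  reading off the coefficient at 0 undoes \<open>eta\<close>.\<close>

lemma epsilon_mult: "epsilon (x * y) = epsilon x * (epsilon y :: 'k::field)"
proof -
  have "eta (epsilon (x * y)) = eta (epsilon x) * (eta (epsilon y) :: 'k parsym)"
    by (rule multiplicativeD[OF multiplicative_eta_epsilon])
  then have "eta (epsilon (x * y)) = (eta (epsilon x * epsilon y) :: 'k parsym)"
    by (simp add: eta_def scale_mult_left scale_mult_right scale_simps mult.commute)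
  from arg_cong[OF this, of "\<lambda>z. Poly_Mapping.lookup z 0"] show ?thesis
    by (simp add: eta_def)
qed

lemma sum_antipode_left:
  assumes "g \<in> irreducibles"
  shows "(\<Sum>p | fst p \<bullet> snd p = g. antipode_S (H (fst p)) * H (snd p)) = (0 :: 'k::field parsym)"
proof -
  let ?P = "{p. fst p \<bullet> snd p = g \<and> snd p \<noteq> 0}"
  have g: "g \<noteq> 0" using assms by (simp add: irreducibles_def)
  \<comment> \<open>The term at \<open>(g, 0)\<close> contributes \<open>antipode_S (H g)\<close>,
    which the remaining terms have to cancel.\<close>
  have split: "{p. fst p \<bullet> snd p = g} = insert (g, 0) ?P" by auto
  have fin: "finite ?P" by (rule finite_subset[OF _ finite_bullet_pairs[of g]]) auto
  have "(\<Sum>p\<in>?P. antipode_S (H (fst p)) * H (snd p))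
      = (\<Sum>p\<in>?P. \<Sum>\<rho>s\<in>nonzero_tuples (fst p). - signed_H (\<rho>s @ [snd p]) :: 'k parsym)"
  proof (rule sum.cong[OF refl])
    fix p assume "p \<in> ?P"
    \<comment> \<open>The explicit formula for \<open>antipode_S\<close> is available only on empty
      and irreducible diagrams.\<close>
    then have "fst p = 0 \<or> fst p \<in> irreducibles"
      using assms bullet_irreducibles[of "fst p" "snd p"] by auto
    then show "antipode_S (H (fst p)) * H (snd p) = (\<Sum>\<rho>s\<in>nonzero_tuples (fst p). - signed_H (\<rho>s @ [snd p]) :: 'k parsym)"
      by (simp add: antipode_S_H signed_H_snoc sum_distrib_right)
  qed
  also have "\<dots> = (\<Sum>(p, \<rho>s)\<in>(SIGMA p:?P. nonzero_tuples (fst p)). - signed_H (\<rho>s @ [snd p]))"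
    by (rule sum.Sigma) (simp_all add: fin finite_nonzero_tuples)
  \<comment> \<open>Appending \<open>snd p\<close> to a tuple for \<open>fst p\<close> is inverted
    by removing the last entry and recovering \<open>fst p\<close> as the product of the others. A
    tuple for \<open>g\<close> has a last entry because \<open>g\<close> is nonempty.\<close>
  also have "\<dots> = (\<Sum>\<rho>s\<in>nonzero_tuples g. - signed_H \<rho>s)"
  proof (rule sum.reindex_bij_witness[where
      i = "\<lambda>\<rho>s. ((foldr (\<bullet>) (butlast \<rho>s) 0, last \<rho>s), butlast \<rho>s)" and j = "\<lambda>(p, \<rho>s). \<rho>s @ [snd p]"])
    fix \<rho>s assume \<rho>s: "\<rho>s \<in> nonzero_tuples g"
    then obtain \<sigma>s \<sigma> where "\<rho>s = \<sigma>s @ [\<sigma>]"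
      using g by (cases \<rho>s rule: rev_cases) (auto simp: nonzero_tuples_def)
    with \<rho>s show "((foldr (\<bullet>) (butlast \<rho>s) 0, last \<rho>s), butlast \<rho>s) \<in> (SIGMA p:?P. nonzero_tuples (fst p))"
      "(case ((foldr (\<bullet>) (butlast \<rho>s) 0, last \<rho>s), butlast \<rho>s) of (p, \<rho>s) \<Rightarrow> \<rho>s @ [snd p]) = \<rho>s"
      by (auto simp: nonzero_tuples_def foldr_bullet_append)
  qed (auto simp: nonzero_tuples_def foldr_bullet_append)
  also have "\<dots> = - antipode_S (H g)"
    using assms by (simp add: antipode_S_H sum_negf)
  finally show ?thesis
    by (simp add: split fin)
qed

lemma sum_antipode_right:
  assumes "g \<in> irreducibles"
  shows "(\<Sum>p | fst p \<bullet> snd p = g. H (fst p) * antipode_S (H (snd p))) = (0 :: 'k::field parsym)"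
proof -
  let ?P = "{p. fst p \<bullet> snd p = g \<and> fst p \<noteq> 0}"
  have g: "g \<noteq> 0" using assms by (simp add: irreducibles_def)
  have split: "{p. fst p \<bullet> snd p = g} = insert (0, g) ?P" by auto
  have fin: "finite ?P" by (rule finite_subset[OF _ finite_bullet_pairs[of g]]) auto
  have "(\<Sum>p\<in>?P. H (fst p) * antipode_S (H (snd p)))
      = (\<Sum>p\<in>?P. \<Sum>\<rho>s\<in>nonzero_tuples (snd p). - signed_H (fst p # \<rho>s) :: 'k parsym)"
  proof (rule sum.cong[OF refl])
    fix p assume "p \<in> ?P"
    then have "snd p = 0 \<or> snd p \<in> irreducibles"
      using assms bullet_irreducibles[of "fst p" "snd p"] by auto
    then show "H (fst p) * antipode_S (H (snd p)) = (\<Sum>\<rho>s\<in>nonzero_tuples (snd p). - signed_H (fst p # \<rho>s) :: 'k parsym)"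
      by (simp add: antipode_S_H signed_H_Cons sum_distrib_left)
  qed
  also have "\<dots> = (\<Sum>(p, \<rho>s)\<in>(SIGMA p:?P. nonzero_tuples (snd p)). - signed_H (fst p # \<rho>s))"
    by (rule sum.Sigma) (simp_all add: fin finite_nonzero_tuples)
  \<comment> \<open>Here the first entry is split off, which the right fold does by
    definition.\<close>
  also have "\<dots> = (\<Sum>\<rho>s\<in>nonzero_tuples g. - signed_H \<rho>s)"
  proof (rule sum.reindex_bij_witness[where
      i = "\<lambda>\<rho>s. ((hd \<rho>s, foldr (\<bullet>) (tl \<rho>s) 0), tl \<rho>s)" and j = "\<lambda>(p, \<rho>s). fst p # \<rho>s"])
    fix \<rho>s assume \<rho>s: "\<rho>s \<in> nonzero_tuples g"
    then obtain \<sigma>s \<sigma> where "\<rho>s = \<sigma> # \<sigma>s"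
      using g by (cases \<rho>s) (auto simp: nonzero_tuples_def)
    with \<rho>s show "((hd \<rho>s, foldr (\<bullet>) (tl \<rho>s) 0), tl \<rho>s) \<in> (SIGMA p:?P. nonzero_tuples (snd p))"
      "(case ((hd \<rho>s, foldr (\<bullet>) (tl \<rho>s) 0), tl \<rho>s) of (p, \<rho>s) \<Rightarrow> fst p # \<rho>s) = \<rho>s"
      by (auto simp: nonzero_tuples_def)
  qed (auto simp: nonzero_tuples_def)
  also have "\<dots> = - antipode_S (H g)"
    using assms by (simp add: antipode_S_H sum_negf)
  finally show ?thesis
    by (simp add: split fin)
qed

lemma tensor_map_H_fst_snd: "tensor_map f g (H p) = tensor (f (H (fst p))) (g (H (snd p)))"
  by (cases p) simp

lemma tensor_assoc_H: "tensor_assoc (H p) = H (fst (fst p), snd (fst p), snd p)"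
  by (simp add: tensor_assoc_def case_prod_beta)

section \<open>The antipode identities on products\<close>

lemma lin_nabla_tensor_map: "lin (\<lambda>X. nabla (tensor_map f g X))"
  by (intro lin_intros)

lemma nabla_tensor_map_H: "nabla (tensor_map f g (H p)) = f (H (fst p)) * g (H (snd p))"
  by (cases p) (simp add: nabla_tensor)

text \<open>On basis vectors, S(q1 p1) q2 p2 = S(p1) (S(q1) q2) p2: the reversal of order by S nests
  the contribution of the left factor inside that of the right one.\<close>

lemma antipode_left_mult_H:
  "nabla (tensor_map antipode_S id (X * H p))
    = antipode_S (H (fst p)) * nabla (tensor_map antipode_S id X) * H (snd p)"
proof (rule lin_eqI[where x = X])
  show "lin (\<lambda>X. nabla (tensor_map antipode_S id (X * H p)))"
    by (intro lin_comp[OF lin_nabla_tensor_map] lin_intros)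
  show "lin (\<lambda>X. antipode_S (H (fst p)) * nabla (tensor_map antipode_S id X) * H (snd p))"
    by (intro lin_mult_left lin_mult_right lin_nabla_tensor_map)
  show "nabla (tensor_map antipode_S id (H q * H p))
      = antipode_S (H (fst p)) * nabla (tensor_map antipode_S id (H q)) * H (snd p)" for q
    unfolding H_add[symmetric] nabla_tensor_map_H fst_add snd_add
    by (simp only: H_add antipode_S_mult id_apply mult.assoc)
qed

text \<open>With S on the second leg the nesting is opposite: p1 q1 S(p2 q2) = p1 (q1 S(q2)) S(p2),
  so the right factor is innermost.\<close>

lemma antipode_right_mult_H:
  "nabla (tensor_map id antipode_S (H p * Y))
    = H (fst p) * nabla (tensor_map id antipode_S Y) * antipode_S (H (snd p))"
proof (rule lin_eqI[where x = Y])
  show "lin (\<lambda>Y. nabla (tensor_map id antipode_S (H p * Y)))"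
    by (intro lin_comp[OF lin_nabla_tensor_map] lin_intros)
  show "lin (\<lambda>Y. H (fst p) * nabla (tensor_map id antipode_S Y) * antipode_S (H (snd p)))"
    by (intro lin_mult_left lin_mult_right lin_nabla_tensor_map)
  show "nabla (tensor_map id antipode_S (H p * H q))
      = H (fst p) * nabla (tensor_map id antipode_S (H q)) * antipode_S (H (snd p))" for q
    unfolding H_add[symmetric] nabla_tensor_map_H fst_add snd_add
    by (simp only: H_add antipode_S_mult id_apply mult.assoc)
qed

lemma lin_zero_map: "lin (\<lambda>x. 0)"
  by (rule linI) (simp_all add: scale_simps)

text \<open>In \<open>Delta (H g) * Y\<close> the generator is innermost and contributes 0 by
  \<open>sum_antipode_left\<close>, whatever \<open>Y\<close> is. This matches the counit, which
  vanishes on \<open>H (g + a)\<close>.\<close>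

lemma antipode_left: "nabla (tensor_map antipode_S id (Delta x)) = eta (epsilon (x :: 'k::field parsym))"
proof (rule diagram_lin_eqI[where x = x])
  show "lin (\<lambda>x. nabla (tensor_map antipode_S id (Delta x)) :: 'k parsym)"
    by (rule lin_comp[OF lin_nabla_tensor_map lin_Delta])
  show "lin (\<lambda>x :: 'k parsym. eta (epsilon x))" by (rule lin_eta_epsilon)
  show "nabla (tensor_map antipode_S id (Delta (H 0))) = eta (epsilon (H 0 :: 'k parsym))"
    unfolding Delta_zero nabla_tensor_map_H antipode_S_zero epsilon_H fst_conv
    by (simp add: eta_def scale_simps)
next
  fix g a assume g: "g \<in> irreducibles"
  have "nabla (tensor_map antipode_S id (Delta (H g))) = (0 :: 'k parsym)"
    using g sum_antipode_left[OF g]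
    by (simp add: Delta_H lin_sum[OF lin_nabla_tensor_map] nabla_tensor_map_H)
  then have "nabla (tensor_map antipode_S id (Delta (H g) * Y)) = (0 :: 'k parsym)" for Y
    by (intro lin_eqI[where x = Y and F = "\<lambda>Y. nabla (tensor_map antipode_S id (Delta (H g) * Y))"]
        lin_comp[OF lin_nabla_tensor_map] lin_mult_right lin_ident lin_zero_map)
      (simp add: antipode_left_mult_H)
  moreover have "g + a \<noteq> 0" using g by (simp add: irreducibles_def)
  ultimately show "nabla (tensor_map antipode_S id (Delta (H (g + a)))) = eta (epsilon (H (g + a) :: 'k parsym))"
    unfolding epsilon_H H_add[of g a] multiplicativeD[OF multiplicative_Delta]
    by (simp add: eta_def scale_simps epsilon_H mult_single)
qed

text \<open>Now \<open>Delta (H a)\<close> is innermost. The induction hypothesis collapses it to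
  the scalar \<open>epsilon (H a)\<close>, which can be pulled out, and the generator that remains
  gives 0.\<close>

lemma antipode_right: "nabla (tensor_map id antipode_S (Delta x)) = eta (epsilon (x :: 'k::field parsym))"
proof (rule diagram_lin_eqI[where x = x])
  show "lin (\<lambda>x. nabla (tensor_map id antipode_S (Delta x)) :: 'k parsym)"
    by (rule lin_comp[OF lin_nabla_tensor_map lin_Delta])
  show "lin (\<lambda>x :: 'k parsym. eta (epsilon x))" by (rule lin_eta_epsilon)
  show "nabla (tensor_map id antipode_S (Delta (H 0))) = eta (epsilon (H 0 :: 'k parsym))"
    unfolding Delta_zero nabla_tensor_map_H antipode_S_zero snd_conv epsilon_H
    by (simp add: eta_def scale_simps)
next
  fix g a
  assume g: "g \<in> irreducibles" and IH: "nabla (tensor_map id antipode_S (Delta (H a))) = eta (epsilon (H a :: 'k parsym))"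
  let ?Y = "Delta (H a :: 'k parsym)"
  have "nabla (tensor_map id antipode_S (X * ?Y)) = scale (epsilon (H a :: 'k parsym)) (nabla (tensor_map id antipode_S X))" for X
  proof (rule lin_eqI[where x = X])
    show "lin (\<lambda>X. nabla (tensor_map id antipode_S (X * ?Y)) :: 'k parsym)"
      by (intro lin_comp[OF lin_nabla_tensor_map] lin_mult_left lin_ident)
    show "lin (\<lambda>X. scale (epsilon (H a :: 'k parsym)) (nabla (tensor_map id antipode_S X)))"
      by (intro lin_scale_left lin_nabla_tensor_map)
    show "nabla (tensor_map id antipode_S (H p * ?Y)) = scale (epsilon (H a :: 'k parsym)) (nabla (tensor_map id antipode_S (H p)))" for p
      by (simp add: antipode_right_mult_H IH nabla_tensor_map_H eta_def scale_mult_left scale_mult_right)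
  qed
  moreover have "nabla (tensor_map id antipode_S (Delta (H g))) = (0 :: 'k parsym)"
    using g sum_antipode_right[OF g]
    by (simp add: Delta_H lin_sum[OF lin_nabla_tensor_map] nabla_tensor_map_H)
  ultimately have "nabla (tensor_map id antipode_S (Delta (H g) * ?Y)) = (0 :: 'k parsym)"
    by (simp add: scale_simps)
  moreover have "g + a \<noteq> 0" using g by (simp add: irreducibles_def)
  ultimately show "nabla (tensor_map id antipode_S (Delta (H (g + a)))) = eta (epsilon (H (g + a) :: 'k parsym))"
    unfolding H_add[of g a] multiplicativeD[OF multiplicative_Delta]
    by (simp add: eta_def scale_simps epsilon_H mult_single)
qed

text \<open>Both sides are multiplicative. On a generator each is the sum over triples whose
  \<open>\<bullet>\<close> product is \<open>g\<close>, bracketed to the left or to the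
  right.\<close>

lemma Delta_coassoc: "tensor_assoc (tensor_map Delta id (Delta x)) = tensor_map id Delta (Delta (x :: 'k::field parsym))"
proof (rule diagram_multiplicative_eqI[where x = x])
  let ?F = "\<lambda>x :: 'k parsym. tensor_assoc (tensor_map Delta id (Delta x))" and ?G = "\<lambda>x :: 'k parsym. tensor_map id Delta (Delta x)"
  show "lin ?F" "lin ?G"
    by (intro lin_comp[OF lin_tensor_assoc] lin_comp[OF lin_tensor_map] lin_Delta)+
  show "multiplicative ?F" "multiplicative ?G"
    by (rule multiplicative_comp[OF multiplicative_tensor_assoc
          multiplicative_comp[OF multiplicative_tensor_map[OF multiplicative_Delta multiplicative_id] multiplicative_Delta]],
        rule multiplicative_comp[OF multiplicative_tensor_map[OF multiplicative_id multiplicative_Delta] multiplicative_Delta])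
  show "?F (H 0) = ?G (H 0)"
    by (simp only: Delta_zero tensor_map_H id_apply tensor_H_H tensor_assoc_def lin_ext_H split)
  fix g assume g: "g \<in> irreducibles"
  let ?P = "\<lambda>\<pi>. {p. fst p \<bullet> snd p = \<pi>}"
  \<comment> \<open>Both components are again empty or irreducible, so \<open>Delta_H\<close>
    applies a second time.\<close>
  have irr: "fst p = 0 \<or> fst p \<in> irreducibles" "snd p = 0 \<or> snd p \<in> irreducibles" if "p \<in> ?P g" for p
    using that g bullet_irreducibles[of "fst p" "snd p"] by auto
  have "?F (H g) = (\<Sum>p\<in>?P g. tensor_assoc (tensor (Delta (H (fst p))) (H (snd p))))"
    using g by (simp add: Delta_H lin_sum[OF lin_tensor_map] lin_sum[OF lin_tensor_assoc] tensor_map_H_fst_snd)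
  also have "\<dots> = (\<Sum>p\<in>?P g. \<Sum>q\<in>?P (fst p). H (fst q, snd q, snd p))"
  proof (rule sum.cong[OF refl])
    fix p assume "p \<in> ?P g"
    have "lin (\<lambda>x :: diagram \<times> diagram \<Rightarrow>\<^sub>0 'k. tensor_assoc (tensor x (H (snd p))))" by (intro lin_intros)
    note sum = lin_sum[OF this]
    show "tensor_assoc (tensor (Delta (H (fst p))) (H (snd p)))
        = (\<Sum>q\<in>?P (fst p). H (fst q, snd q, snd p) :: _ \<Rightarrow>\<^sub>0 'k)"
      by (simp only: Delta_H[OF irr(1)[OF \<open>p \<in> ?P g\<close>]] sum tensor_H_H tensor_assoc_H fst_conv snd_conv)
  qed
  also have "\<dots> = (\<Sum>(p, q)\<in>(SIGMA p:?P g. ?P (fst p)). H (fst q, snd q, snd p))"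
    by (rule sum.Sigma) (simp_all add: finite_bullet_pairs)
  \<comment> \<open>Rebracketing a triple product; \<open>bullet_assoc\<close> shows that both maps
    stay within the index sets.\<close>
  also have "\<dots> = (\<Sum>(p, q)\<in>(SIGMA p:?P g. ?P (snd p)). H (fst p, fst q, snd q))"
    by (rule sum.reindex_bij_witness[where
      i = "\<lambda>(p, q). ((fst p \<bullet> fst q, snd q), (fst p, fst q))" and
      j = "\<lambda>(p, q). ((fst q, snd q \<bullet> snd p), (snd q, snd p))"])
      (auto simp: bullet_assoc)
  also have "\<dots> = (\<Sum>p\<in>?P g. \<Sum>q\<in>?P (snd p). H (fst p, fst q, snd q))"
    by (rule sum.Sigma[symmetric]) (simp_all add: finite_bullet_pairs)
  also have "\<dots> = (\<Sum>p\<in>?P g. tensor (H (fst p)) (Delta (H (snd p))))"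
  proof (rule sum.cong[OF refl])
    fix p assume "p \<in> ?P g"
    have "lin (\<lambda>x :: diagram \<times> diagram \<Rightarrow>\<^sub>0 'k. tensor (H (fst p)) x)" by (intro lin_intros)
    note sum = lin_sum[OF this]
    show "(\<Sum>q\<in>?P (snd p). H (fst p, fst q, snd q)) = tensor (H (fst p)) (Delta (H (snd p) :: 'k parsym))"
      by (simp only: Delta_H[OF irr(2)[OF \<open>p \<in> ?P g\<close>]] sum tensor_H_H prod.collapse)
  qed
  also have "\<dots> = ?G (H g)"
    using g by (simp add: Delta_H lin_sum[OF lin_tensor_map] tensor_map_H_fst_snd)
  finally show "?F (H g) = ?G (H g)" .
qed

lemma Delta_counit_left: "lin_ext (\<lambda>(a, b). scale (epsilon (H a)) (H b)) (Delta x) = (x :: 'k::field parsym)"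
proof (rule diagram_multiplicative_eqI[where x = x])
  let ?K = "lin_ext (\<lambda>(a, b). scale (epsilon (H a :: 'k parsym)) (H b :: 'k parsym))"
  show "lin (\<lambda>x. ?K (Delta x))" by (intro lin_comp[OF lin_lin_ext] lin_Delta)
  show "lin (\<lambda>x. x)" by (rule lin_ident)
  have "multiplicative ?K"
    \<comment> \<open>A tensor product of diagrams is empty only if both factors are, so the counit
      coefficients multiply.\<close>
    by (rule multiplicativeI[OF lin_lin_ext])
      (auto simp: epsilon_H scale_simps mult_single split: if_splits)
  then show "multiplicative (\<lambda>x. ?K (Delta x))"
    by (rule multiplicative_comp) (rule multiplicative_Delta)
  show "multiplicative (\<lambda>x :: 'k parsym. x)" by (simp add: multiplicative_def)
  show "?K (Delta (H 0)) = H 0" by (simp only: Delta_zero lin_ext_H split epsilon_H scale_simps if_True refl)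
  fix g assume g: "g \<in> irreducibles"
  have "?K (Delta (H g)) = (\<Sum>p | fst p \<bullet> snd p = g. scale (epsilon (H (fst p) :: 'k parsym)) (H (snd p)))"
    using g by (simp add: Delta_H lin_sum[OF lin_lin_ext] case_prod_beta)
  \<comment> \<open>The counit kills every term with a nonempty first component, and an empty one
    forces the second to be \<open>g\<close>.\<close>
  also have "\<dots> = (\<Sum>p | fst p \<bullet> snd p = g. if p = (0, g) then H g else 0)"
    by (rule sum.cong) (auto simp: epsilon_H scale_simps)
  also have "\<dots> = H g" by (simp add: finite_bullet_pairs)
  finally show "?K (Delta (H g)) = H g" .
qed

lemma Delta_counit_right: "lin_ext (\<lambda>(a, b). scale (epsilon (H b)) (H a)) (Delta x) = (x :: 'k::field parsym)"
proof (rule diagram_multiplicative_eqI[where x = x])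
  let ?K = "lin_ext (\<lambda>(a, b). scale (epsilon (H b :: 'k parsym)) (H a :: 'k parsym))"
  show "lin (\<lambda>x. ?K (Delta x))" by (intro lin_comp[OF lin_lin_ext] lin_Delta)
  show "lin (\<lambda>x. x)" by (rule lin_ident)
  have "multiplicative ?K"
    by (rule multiplicativeI[OF lin_lin_ext])
      (auto simp: epsilon_H scale_simps mult_single split: if_splits)
  then show "multiplicative (\<lambda>x. ?K (Delta x))"
    by (rule multiplicative_comp) (rule multiplicative_Delta)
  show "multiplicative (\<lambda>x :: 'k parsym. x)" by (simp add: multiplicative_def)
  show "?K (Delta (H 0)) = H 0" by (simp only: Delta_zero lin_ext_H split epsilon_H scale_simps if_True refl)
  fix g assume g: "g \<in> irreducibles"
  have "?K (Delta (H g)) = (\<Sum>p | fst p \<bullet> snd p = g. scale (epsilon (H (snd p) :: 'k parsym)) (H (fst p)))"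
    using g by (simp add: Delta_H lin_sum[OF lin_lin_ext] case_prod_beta)
  also have "\<dots> = (\<Sum>p | fst p \<bullet> snd p = g. if p = (g, 0) then H g else 0)"
    by (rule sum.cong) (auto simp: epsilon_H scale_simps)
  also have "\<dots> = H g" by (simp add: finite_bullet_pairs)
  finally show "?K (Delta (H g)) = H g" .
qed

text \<open>This links the abstract product of the tensor square in \<open>hopf_algebra\<close> to
  the library product on pairs, so that the bialgebra axiom becomes multiplicativity of
  \<open>Delta\<close>.\<close>

lemma tensor_map_nabla_middle_swap:
  "tensor_map nabla nabla (tensor_middle_swap (tensor X Y)) = X * Y"
proof (rule bilinear_eqI[of "\<lambda>X Y. tensor_map nabla nabla (tensor_middle_swap (tensor X Y))" "\<lambda>X Y. X * Y"])
  show "tensor_map nabla nabla (tensor_middle_swap (tensor (H p) (H q))) = H p * H q" for p q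
    by (cases p; cases q) (simp add: tensor_H_H tensor_middle_swap_def mult_single)
qed (intro lin_intros)+

lemma vector_space_mult: "vector_space ((*) :: 'k::field \<Rightarrow> 'k \<Rightarrow> 'k)"
  by unfold_locales (simp_all add: algebra_simps)

lemma hopf_algebra_parsym:
  "hopf_algebra (nabla :: (diagram \<times> diagram \<Rightarrow>\<^sub>0 'k::field) \<Rightarrow> 'k parsym) eta Delta epsilon antipode_S"
proof (rule hopf_algebra.intro)
  note [simp] = Vector_Spaces.linear_iff vector_space_scale vector_space_mult
  show "lin (nabla :: _ \<Rightarrow> 'k parsym)" by (rule lin_nabla)
  show "Vector_Spaces.linear (*) scale (eta :: 'k \<Rightarrow> 'k parsym)"
    by (simp add: eta_def scale_simps)
  show "lin (Delta :: 'k parsym \<Rightarrow> _)" by (rule lin_Delta)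
  show "Vector_Spaces.linear scale (*) (epsilon :: 'k parsym \<Rightarrow> 'k)"
    by (simp add: epsilon_eq lookup_add)
  show "lin (antipode_S :: 'k parsym \<Rightarrow> _)" by (rule lin_antipode_S)
  fix t :: "(diagram \<times> diagram) \<times> diagram \<Rightarrow>\<^sub>0 'k" and u :: "diagram \<times> diagram \<Rightarrow>\<^sub>0 'k" and x y :: "'k parsym" and c :: 'k
  show "nabla (tensor_map nabla id t) = nabla (tensor_map id nabla (tensor_assoc t))"
  proof (rule lin_eqI[where x = t])
    show "lin (\<lambda>t. nabla (tensor_map nabla id t) :: 'k parsym)" by (intro lin_intros)
    show "lin (\<lambda>t. nabla (tensor_map id nabla (tensor_assoc t)) :: 'k parsym)" by (intro lin_intros)
    show "nabla (tensor_map nabla id (H p)) = (nabla (tensor_map id nabla (tensor_assoc (H p))) :: 'k parsym)" for p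
      by (cases p; cases "fst p") (simp add: tensor_assoc_def nabla_tensor mult_single add.assoc)
  qed
  show "nabla (tensor (eta c) x) = scale c x" "nabla (tensor x (eta c)) = scale c x"
    by (simp_all add: nabla_tensor eta_def scale_mult_left scale_mult_right)
  show "tensor_assoc (tensor_map Delta id (Delta x)) = tensor_map id Delta (Delta x)"
    by (rule Delta_coassoc)
  show "lin_ext (\<lambda>(a, b). scale (epsilon (H a)) (H b)) (Delta x) = x" by (rule Delta_counit_left)
  show "lin_ext (\<lambda>(a, b). scale (epsilon (H b)) (H a)) (Delta x) = x" by (rule Delta_counit_right)
  show "Delta (nabla u) = tensor_map nabla nabla (tensor_middle_swap (tensor_map Delta Delta u))"
  proof (rule lin_eqI[where x = u])
    show "lin (\<lambda>u. Delta (nabla u) :: diagram \<times> diagram \<Rightarrow>\<^sub>0 'k)" by (rule lin_comp[OF lin_Delta lin_nabla])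
    show "lin (\<lambda>u. tensor_map nabla nabla (tensor_middle_swap (tensor_map Delta Delta u)) :: diagram \<times> diagram \<Rightarrow>\<^sub>0 'k)"
      by (intro lin_intros)
    show "Delta (nabla (H p)) = (tensor_map nabla nabla (tensor_middle_swap (tensor_map Delta Delta (H p)))
        :: diagram \<times> diagram \<Rightarrow>\<^sub>0 'k)" for p
      by (cases p) (simp add: tensor_map_nabla_middle_swap H_add multiplicativeD[OF multiplicative_Delta] del: mult_single)
  qed
  show "Delta (eta 1) = tensor (eta 1) (eta 1 :: 'k parsym)"
    by (simp only: eta_def scale_simps Delta_zero tensor_H_H)
  show "epsilon (nabla (tensor x y)) = epsilon x * epsilon y"
    by (simp add: nabla_tensor epsilon_mult)
  show "epsilon (eta 1 :: 'k parsym) = 1"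
    by (simp add: eta_def epsilon_eq)
  show "nabla (tensor_map antipode_S id (Delta x)) = eta (epsilon x)" by (rule antipode_left)
  show "nabla (tensor_map id antipode_S (Delta x)) = eta (epsilon x)" by (rule antipode_right)
qed

theorem theorem3p12:
  shows "(\<forall>x :: 'k::field parsym.
            nabla (tensor_map antipode_S id (Delta x)) = eta (epsilon x) \<and>
            nabla (tensor_map id antipode_S (Delta x)) = eta (epsilon x)) \<and>
         hopf_algebra (nabla :: (diagram \<times> diagram \<Rightarrow>\<^sub>0 'k) \<Rightarrow> 'k parsym) eta Delta epsilon antipode_S"
  using antipode_left antipode_right hopf_algebra_parsym by blast

end
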